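(* Let $(S,\mathcal S)$ be a metric space with its Borel $\sigma$-field and let $X=(X_n,n\in\mathbb T)$ be a bifurcating Markov chain on $S$ with initial distribution $\nu$ and $\mathbb T$-transition probability $P$. Let $F$ be an admissible space of functions with limit probability $\mu$. Let $f\in F$ be such that $(\mu,f)=\int_S f\,d\mu=0$. Assume that there exists $h\in F$ such that $$P\Big(\sum_{r\in\mathbb N}|Q^rf\otimes Q^rf|\Big)\le h .$$ Then $\overline M_{\mathbb G_q}(f)$ (as $q\to\infty$) and $\overline M_{\mathbb T_r}(f)$ (as $r\to\infty$) almost surely converge to $0$.
   Context: Tree. $\mathbb T=\mathbb N^*=\{1,2,\dots\}$ is the binary tree: vertex $n$ has two daughters $2n$ and $2n+1$, the root is $1$. $\mathbb G_q=\{2^q,\dots,2^{q+1}-1\}$ is the $q$th generation, $\mathbb T_r=\bigcup_{q=0}^r\mathbb G_q$, $r_n=\lfloor\log_2 n\rfloor$ is the generation of $n$. $\mathbb T$-transition probability. A map $P:S\times\mathcal S^2\to[0,1]$ ($\mathcal S^2$ the product $\sigma$-field on $S^2$) such that $P(\cdot,A)$ is measurable for all $A\in\mathcal S^2$ and $P(x,\cdot)$ is a probability on $(S^2,\mathcal S^2)$ for all $x\in S$. Put $P_0(x,B)=P(x,B\times S)$, $P_1(x,B)=P(x,S\times B)$, $Q=(P_0+P_1)/2$; $Q^r$ is the $r$th iterate of $Q$ and $Q^rf(x)=\int_S f(y)Q^r(x,dy)$. For measurable $f:S^2\to\mathbb R$, $Pf(x)=\int_{S^2}f(y,z)P(x,dy\,dz)$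 when defined. Bifurcating Markov chain. On a filtered probability space $(\Omega,\mathcal F,(\mathcal F_r)_{r\in\mathbb N},\mathbb P)$, a family $(X_n,n\in\mathbb T)$ of $S$-valued random variables is a bifurcating Markov chain with initial distribution $\nu$ and $\mathbb T$-transition probability $P$ if $X_n$ is $\mathcal F_{r_n}$-measurable for all $n$, $X_1$ has law $\nu$, and for all $q\in\mathbb N$ and all families $(f_n,n\in\mathbb G_q)$ of bounded measurable functions on $S^2$, $\mathbb E[\prod_{n\in\mathbb G_q}f_n(X_{2n},X_{2n+1})\mid\mathcal F_q]=\prod_{n\in\mathbb G_q}Pf_n(X_n)$. The default filtration is $\mathcal F_r=\sigma(X_i,i\in\mathbb T_r)$. Admissible space. Let $\mathcal B(S)$ be the set of measurable functions $S\to\mathbb R$, and $(f\otimes g)(y,z)=f(y)g(z)$. A linear subspace $F\subset\mathcal B(S)$ is called admissible with limit probability $\mu$ (relative to $P,\nu$) if: (i) $F$ contains the constants; (ii) $f^2\in F$ for all $f\in F$; (iii) for all $f,g\in F$, $f\otimes g\in L^1(P(x,\cdot))$ for all $x\in S$, and $P(f\otimes g)\in F$; (iv) $\mu$ is a probability on $(S,\mathcal S)$ with $F\subset L^1(\mu)$ and $\lim_{r\to\infty}Q^rf(x)=\int_S f\,d\mu$ for all $x\in S$ and $f\in F$; (v) for all $f\in F$ there is $g\in F$ such that $|Q^rf|\le g$ for all $r\in\mathbb N$; (vi) $F\subset L^1(\nu)$. (Conditions (i) and (iii) imply that $Q^rf$ is well defined for $f\in F$.) Averages. For measurable $f:S\to\mathbb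 R$ and finite $I\subset\mathbb T$: $\overline M_I(f)=|I|^{-1}\sum_{i\in I}f(X_i)$. *)

theory Defs
  imports "HOL-Probability.Probability"
begin

text \<open>The binary tree is the set of positive naturals; \<open>n\<close> has the daughters \<open>2 n\<close> and \<open>2 n + 1\<close>.\<close>

definition generation :: "nat \<Rightarrow> nat set" where
  "generation q = {2 ^ q ..< 2 ^ (q + 1)}"

definition tree_upto :: "nat \<Rightarrow> nat set" where
  "tree_upto r = (\<Union>q\<in>{0..r}. generation q)"

definition gen_of :: "nat \<Rightarrow> nat" where
  "gen_of n = nat \<lfloor>log 2 (real n)\<rfloor>"

text \<open>
  The product \<open>\<sigma>\<close>-field on pairs is \<open>borel \<Otimes>\<^sub>M borel\<close>, which can be strictly smaller than the
  Borel \<open>\<sigma>\<close>-field of the product space, since the metric space need not be separable.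
\<close>

definition T_transition :: "('a::metric_space \<Rightarrow> ('a \<times> 'a) measure) \<Rightarrow> bool" where
  "T_transition P \<longleftrightarrow>
     (\<forall>x. prob_space (P x) \<and> sets (P x) = sets (borel \<Otimes>\<^sub>M borel)) \<and>
     (\<forall>A \<in> sets (borel \<Otimes>\<^sub>M borel). (\<lambda>x. emeasure (P x) A) \<in> borel_measurable borel)"

definition P0 :: "('a::metric_space \<Rightarrow> ('a \<times> 'a) measure) \<Rightarrow> 'a \<Rightarrow> 'a measure" where
  "P0 P x = distr (P x) borel fst"

definition P1 :: "('a::metric_space \<Rightarrow> ('a \<times> 'a) measure) \<Rightarrow> 'a \<Rightarrow> 'a measure" where
  "P1 P x = distr (P x) borel snd"

definition Qker :: "('a::metric_space \<Rightarrow> ('a \<times> 'a) measure) \<Rightarrow> 'a \<Rightarrow> 'a measure" where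
  "Qker P x = measure_of UNIV (sets borel)
     (\<lambda>B. (emeasure (P0 P x) B + emeasure (P1 P x) B) / 2)"

primrec kernel_iter :: "('a::metric_space \<Rightarrow> 'a measure) \<Rightarrow> nat \<Rightarrow> 'a \<Rightarrow> 'a measure" where
  "kernel_iter K 0 = (\<lambda>x. return borel x)"
| "kernel_iter K (Suc r) = (\<lambda>x. bind (K x) (kernel_iter K r))"

definition kernel_apply :: "('a \<Rightarrow> 'b measure) \<Rightarrow> ('b \<Rightarrow> real) \<Rightarrow> 'a \<Rightarrow> real" where
  "kernel_apply K f x = (\<integral>y. f y \<partial>(K x))"

definition Qpow :: "('a::metric_space \<Rightarrow> ('a \<times> 'a) measure) \<Rightarrow> nat \<Rightarrow> ('a \<Rightarrow> real) \<Rightarrow> 'a \<Rightarrow> real" where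
  "Qpow P r f = kernel_apply (kernel_iter (Qker P) r) f"

definition tensor :: "('a \<Rightarrow> real) \<Rightarrow> ('a \<Rightarrow> real) \<Rightarrow> 'a \<times> 'a \<Rightarrow> real" where
  "tensor f g = (\<lambda>(y, z). f y * g z)"

definition filtered_prob_space :: "'w measure \<Rightarrow> (nat \<Rightarrow> 'w measure) \<Rightarrow> bool" where
  "filtered_prob_space M Fil \<longleftrightarrow>
     prob_space M \<and> filtration (space M) Fil \<and> (\<forall>r. subalgebra M (Fil r))"

text \<open>The variables are indexed by all naturals, but \<open>X 0\<close> is unconstrained and never used.\<close>

definition bifurcating_markov_chain ::
  "'w measure \<Rightarrow> (nat \<Rightarrow> 'w measure) \<Rightarrow> (nat \<Rightarrow> 'w \<Rightarrow> 'a::metric_space) \<Rightarrow>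
   'a measure \<Rightarrow> ('a \<Rightarrow> ('a \<times> 'a) measure) \<Rightarrow> bool" where
  "bifurcating_markov_chain M Fil X \<nu> P \<longleftrightarrow>
     filtered_prob_space M Fil \<and>
     T_transition P \<and>
     (\<forall>n\<ge>1. X n \<in> Fil (gen_of n) \<rightarrow>\<^sub>M borel) \<and>
     distr M borel (X 1) = \<nu> \<and>
     (\<forall>q. \<forall>f :: nat \<Rightarrow> 'a \<times> 'a \<Rightarrow> real.
        (\<forall>n\<in>generation q.
           f n \<in> borel_measurable (borel \<Otimes>\<^sub>M borel) \<and> bounded (range (f n))) \<longrightarrow>
        (AE \<omega> in M.
           real_cond_exp M (Fil q)
             (\<lambda>\<omega>. \<Prod>n\<in>generation q. f n (X (2 * n) \<omega>, X (2 * n + 1) \<omega>)) \<omega> =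
           (\<Prod>n\<in>generation q. kernel_apply P (f n) (X n \<omega>))))"

definition function_subspace :: "('a \<Rightarrow> real) set \<Rightarrow> bool" where
  "function_subspace F \<longleftrightarrow>
     (\<lambda>x. 0) \<in> F \<and>
     (\<forall>f\<in>F. \<forall>g\<in>F. (\<lambda>x. f x + g x) \<in> F) \<and>
     (\<forall>c. \<forall>f\<in>F. (\<lambda>x. c * f x) \<in> F)"

definition admissible ::
  "('a::metric_space \<Rightarrow> ('a \<times> 'a) measure) \<Rightarrow> 'a measure \<Rightarrow> 'a measure \<Rightarrow> ('a \<Rightarrow> real) set \<Rightarrow> bool" where
  "admissible P \<nu> \<mu> F \<longleftrightarrow>
     F \<subseteq> borel_measurable borel \<and>
     function_subspace F \<and>
     (\<forall>c. (\<lambda>x. c) \<in> F) \<and>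
     (\<forall>f\<in>F. (\<lambda>x. (f x)\<^sup>2) \<in> F) \<and>
     (\<forall>f\<in>F. \<forall>g\<in>F. (\<forall>x. integrable (P x) (tensor f g)) \<and> kernel_apply P (tensor f g) \<in> F) \<and>
     (prob_space \<mu> \<and> sets \<mu> = sets borel \<and>
      (\<forall>f\<in>F. integrable \<mu> f) \<and>
      (\<forall>f\<in>F. \<forall>x. (\<lambda>r. Qpow P r f x) \<longlonglongrightarrow> (\<integral>y. f y \<partial>\<mu>))) \<and>
     (\<forall>f\<in>F. \<exists>g\<in>F. \<forall>r x. \<bar>Qpow P r f x\<bar> \<le> g x) \<and>
     (\<forall>f\<in>F. integrable \<nu> f)"

definition average :: "(nat \<Rightarrow> 'w \<Rightarrow> 'a) \<Rightarrow> nat set \<Rightarrow> ('a \<Rightarrow> real) \<Rightarrow> 'w \<Rightarrow> real" where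
  "average X I f \<omega> = (\<Sum>i\<in>I. f (X i \<omega>)) / real (card I)"

lemma sets_Qker [simp]: "sets (Qker P x) = sets borel"
  unfolding Qker_def by (metis sets.sigma_sets_eq sets_measure_of space_borel sets.space_closed)

lemma space_Qker [simp]: "space (Qker P x) = UNIV"
  using sets_eq_imp_space_eq[OF sets_Qker] by simp

lemma emeasure_Qker:
  assumes "T_transition P" "B \<in> sets borel"
  shows "emeasure (Qker P x) B = (emeasure (P x) (B \<times> UNIV) + emeasure (P x) (UNIV \<times> B)) / 2"
proof -
  have s: "sets (P x) = sets (borel \<Otimes>\<^sub>M borel)"
    using assms by (simp add: T_transition_def)
  have sp: "space (P x) = UNIV"
    using sets_eq_imp_space_eq[OF s] by (simp add: space_pair_measure)
  have m: "fst \<in> P x \<rightarrow>\<^sub>M borel" "snd \<in> P x \<rightarrow>\<^sub>M borel"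
    unfolding measurable_cong_sets[OF s refl] by simp_all
  have "emeasure (Qker P x) B = (emeasure (P0 P x) B + emeasure (P1 P x) B) / 2"
    unfolding Qker_def
  proof (rule emeasure_measure_of_sigma)
    show "sigma_algebra UNIV (sets (borel :: 'a measure))"
      using sets.sigma_algebra_axioms[of "borel :: 'a measure"] by simp
    show "positive (sets borel) (\<lambda>B. (emeasure (P0 P x) B + emeasure (P1 P x) B) / 2)"
      by (simp add: positive_def)
    show "countably_additive (sets borel) (\<lambda>B. (emeasure (P0 P x) B + emeasure (P1 P x) B) / 2)"
    proof (rule countably_additiveI)
      fix A :: "nat \<Rightarrow> 'a set"
      assume A: "range A \<subseteq> sets borel" "disjoint_family A" "(\<Union>i. A i) \<in> sets borel"
      have "(\<Sum>i. emeasure (P0 P x) (A i)) = emeasure (P0 P x) (\<Union>i. A i)"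
        "(\<Sum>i. emeasure (P1 P x) (A i)) = emeasure (P1 P x) (\<Union>i. A i)"
        using A by (auto intro!: suminf_emeasure simp: P0_def P1_def)
      then show "(\<Sum>i. (emeasure (P0 P x) (A i) + emeasure (P1 P x) (A i)) / 2) =
          (emeasure (P0 P x) (\<Union>i. A i) + emeasure (P1 P x) (\<Union>i. A i)) / 2"
        by (simp add: divide_ennreal_def suminf_add[symmetric])
    qed
  qed (use assms in auto)
  moreover have "emeasure (P0 P x) B = emeasure (P x) (B \<times> UNIV)"
    unfolding P0_def using assms m by (subst emeasure_distr) (auto simp: sp intro!: arg_cong[of _ _ "emeasure (P x)"])
  moreover have "emeasure (P1 P x) B = emeasure (P x) (UNIV \<times> B)"
    unfolding P1_def using assms m by (subst emeasure_distr) (auto simp: sp intro!: arg_cong[of _ _ "emeasure (P x)"])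
  ultimately show ?thesis by simp
qed

lemma prob_space_Qker:
  assumes "T_transition P"
  shows "prob_space (Qker P x)"
proof
  have s: "sets (P x) = sets (borel \<Otimes>\<^sub>M borel)" and p: "prob_space (P x)"
    using assms by (simp_all add: T_transition_def)
  have sp: "space (P x) = UNIV"
    using sets_eq_imp_space_eq[OF s] by (simp add: space_pair_measure)
  have "emeasure (P x) UNIV = 1"
    using prob_space.emeasure_space_1[OF p] sp by simp
  then have "emeasure (Qker P x) (space (Qker P x)) = (1 + 1) / 2"
    using emeasure_Qker[OF assms, of UNIV x] by simp
  also have "\<dots> = (1 :: ennreal)"
    using ennreal_divide_self[of "2 :: ennreal"] by simp
  finally show "emeasure (Qker P x) (space (Qker P x)) = 1" .
qed

lemma Qker_measurable:
  assumes "T_transition P"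
  shows "Qker P \<in> borel \<rightarrow>\<^sub>M prob_algebra borel"
proof (rule measurable_prob_algebraI)
  show "prob_space (Qker P x)" for x
    using assms by (rule prob_space_Qker)
  show "Qker P \<in> borel \<rightarrow>\<^sub>M subprob_algebra borel"
  proof (rule measurable_subprob_algebra)
    fix A :: "'a set" assume A: "A \<in> sets borel"
    have "A \<times> UNIV \<in> sets (borel \<Otimes>\<^sub>M borel :: ('a \<times> 'a) measure)"
      "UNIV \<times> A \<in> sets (borel \<Otimes>\<^sub>M borel :: ('a \<times> 'a) measure)"
      using A by auto
    then have [measurable]: "(\<lambda>x. emeasure (P x) (A \<times> UNIV)) \<in> borel_measurable borel"
      "(\<lambda>x. emeasure (P x) (UNIV \<times> A)) \<in> borel_measurable borel"
      using assms by (simp_all add: T_transition_def)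
    show "(\<lambda>x. emeasure (Qker P x) A) \<in> borel_measurable borel"
      unfolding emeasure_Qker[OF assms A] by measurable
  qed (use assms in \<open>auto intro: prob_space_imp_subprob_space prob_space_Qker\<close>)
qed

lemma kernel_iter_measurable:
  assumes "K \<in> borel \<rightarrow>\<^sub>M prob_algebra borel"
  shows "kernel_iter K r \<in> borel \<rightarrow>\<^sub>M prob_algebra borel"
proof (induction r)
  case 0
  then show ?case by (auto simp: measurable_return_prob_space)
next
  case (Suc r)
  then show ?case
    using measurable_bind_prob_space[OF assms Suc] by simp
qed

lemma emeasure_kernel_iter_Suc:
  assumes "K \<in> borel \<rightarrow>\<^sub>M prob_algebra borel" "A \<in> sets borel"
  shows "emeasure (kernel_iter K (Suc r) x) A = (\<integral>\<^sup>+y. emeasure (kernel_iter K r y) A \<partial>(K x))"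
  using emeasure_bind_prob_algebra[OF _ kernel_iter_measurable[OF assms(1)] assms(2)]
    measurable_space[OF assms(1)] by simp

end

theory Submission
  imports Defs
begin

text \<open>
  The averages over \<open>\<GG>\<^sub>q\<close> satisfy \<open>\<Sum>\<^sub>q \<E> (M\<^sub>q f)\<^sup>2 < \<infinity>\<close>. Split the second moment into
  the diagonal part, which is \<open>2\<^sup>-\<^sup>q \<nu> Q\<^sup>q f\<^sup>2\<close>, and the part coming from pairs of distinct vertices.
  Conditioning on generation \<open>q\<close>, pairs of generation \<open>q + 1\<close> with different mothers contribute the
  off-diagonal part of generation \<open>q\<close> for \<open>Q f\<close>, and pairs of sisters contribute
  \<open>2\<^sup>-\<^sup>q\<^sup>-\<^sup>1 \<nu> Q\<^sup>q P (f \<otimes> f)\<close>. Iterating, the off-diagonal part is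
  \<open>\<Sum>\<^sub>r \<^sub>< \<^sub>q 2\<^sup>r\<^sup>-\<^sup>q \<nu> Q\<^sup>q\<^sup>-\<^sup>1\<^sup>-\<^sup>r P (Q\<^sup>r f \<otimes> Q\<^sup>r f)\<close>, whose sum over \<open>q\<close> is at most
  \<open>\<Sum>\<^sub>s 2\<^sup>-\<^sup>s\<^sup>-\<^sup>1 \<nu> Q\<^sup>s h < \<infinity>\<close>. The averages over \<open>\<TT>\<^sub>r\<close> are weighted means of those over
  \<open>\<GG>\<^sub>q\<close>, \<open>q \<le> r\<close>, with geometric weights.
\<close>

section \<open>Transition kernels\<close>

text \<open>The last part turns measurability of \<open>emeasure (P x) A\<close> in
  \<open>x\<close>, for each \<open>A\<close>, into measurability into \<open>prob_algebra\<close>,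
  the form that makes \<open>kernel_apply P \<phi>\<close> measurable.\<close>

lemma T_transitionD:
  assumes "T_transition P"
  shows "prob_space (P x)" "sets (P x) = sets (borel \<Otimes>\<^sub>M borel)" "space (P x) = UNIV"
    "P \<in> borel \<rightarrow>\<^sub>M prob_algebra (borel \<Otimes>\<^sub>M borel)"
proof -
  show p: "prob_space (P x)" and s: "sets (P x) = sets (borel \<Otimes>\<^sub>M borel)" for x
    using assms by (auto simp: T_transition_def)
  show "space (P x) = UNIV"
    using sets_eq_imp_space_eq[OF s] by (simp add: space_pair_measure)
  show "P \<in> borel \<rightarrow>\<^sub>M prob_algebra (borel \<Otimes>\<^sub>M borel)"
  proof (rule measurable_prob_algebraI)
    show "P \<in> borel \<rightarrow>\<^sub>M subprob_algebra (borel \<Otimes>\<^sub>M borel)"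
      using assms p s
      by (intro measurable_subprob_algebra) (auto simp: T_transition_def intro: prob_space_imp_subprob_space)
  qed (rule p)
qed

lemma kernel_apply_measurable:
  assumes "K \<in> borel \<rightarrow>\<^sub>M prob_algebra N" "\<phi> \<in> borel_measurable N"
  shows "kernel_apply K \<phi> \<in> borel_measurable borel"
  unfolding kernel_apply_def
  by (rule measurable_compose[OF measurable_prob_algebraD[OF assms(1)]
        integral_measurable_subprob_algebra[OF assms(2)]])

text \<open>\<open>Qker\<close> is defined by its values on sets, so \<open>emeasure_Qker\<close> is
  the case of indicators. Scaling, addition and increasing limits extend it to all nonnegative
  measurable functions.\<close>

lemma nn_integral_Qker:
  assumes T: "T_transition P" and u: "u \<in> borel_measurable borel"
  shows "(\<integral>\<^sup>+y. u y \<partial>(Qker P x)) = ((\<integral>\<^sup>+p. u (fst p) \<partial>P x) + (\<integral>\<^sup>+p. u (snd p) \<partial>P x)) / 2"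
proof -
  note [measurable_cong] = T_transitionD(2)[OF T]
  have c: "f \<in> borel_measurable (Qker P x) \<longleftrightarrow> f \<in> borel_measurable borel" for f :: "'a \<Rightarrow> ennreal"
    by (simp add: measurable_cong_sets[OF sets_Qker refl])
  show ?thesis
    using u
  proof (induction rule: borel_measurable_induct)
    case (cong f g)
    then show ?case by simp
  next
    case (set A)
    have "A \<times> UNIV \<in> sets (P x)" "UNIV \<times> A \<in> sets (P x)"
      using set T_transitionD(2)[OF T, of x] by auto
    moreover have "(\<integral>\<^sup>+p. indicator A (fst p) \<partial>P x) = (\<integral>\<^sup>+p. indicator (A \<times> UNIV) p \<partial>P x)"
      "(\<integral>\<^sup>+p. indicator A (snd p) \<partial>P x) = (\<integral>\<^sup>+p. indicator (UNIV \<times> A) p \<partial>P x)"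
      by (auto intro!: nn_integral_cong simp: indicator_def)
    ultimately show ?case
      using set emeasure_Qker[OF T set] by simp
  next
    case (mult u c)
    then show ?case
      by (simp add: nn_integral_cmult c distrib_left ennreal_times_divide)
  next
    case (add u v)
    then show ?case
      by (simp add: nn_integral_add c divide_ennreal_def distrib_right distrib_left ac_simps)
  next
    case (seq U)
    have [measurable]: "U i \<in> borel_measurable borel" for i by (rule seq)
    have inc: "incseq (\<lambda>i p. U i (fst p))" "incseq (\<lambda>i p. U i (snd p))"
      using \<open>incseq U\<close> by (auto simp: incseq_def le_fun_def)
    have inc': "incseq (\<lambda>i. \<integral>\<^sup>+p. U i (fst p) \<partial>P x)" "incseq (\<lambda>i. \<integral>\<^sup>+p. U i (snd p) \<partial>P x)"
      using \<open>incseq U\<close> by (auto simp: incseq_def le_fun_def intro!: nn_integral_mono)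
    have "(\<integral>\<^sup>+y. (SUP i. U i) y \<partial>(Qker P x)) = (SUP i. \<integral>\<^sup>+y. U i y \<partial>(Qker P x))"
      unfolding SUP_apply using \<open>incseq U\<close>
      by (intro nn_integral_monotone_convergence_SUP) (auto simp: c)
    also have "\<dots> = (SUP i. ((\<integral>\<^sup>+p. U i (fst p) \<partial>P x) + (\<integral>\<^sup>+p. U i (snd p) \<partial>P x)) / 2)"
      using seq by simp
    also have "\<dots> = (SUP i. ((\<integral>\<^sup>+p. U i (fst p) \<partial>P x) + (\<integral>\<^sup>+p. U i (snd p) \<partial>P x))) / 2"
      unfolding divide_ennreal_def by (rule SUP_mult_right_ennreal[symmetric])
    also have "(SUP i. ((\<integral>\<^sup>+p. U i (fst p) \<partial>P x) + (\<integral>\<^sup>+p. U i (snd p) \<partial>P x))) =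
        (SUP i. \<integral>\<^sup>+p. U i (fst p) \<partial>P x) + (SUP i. \<integral>\<^sup>+p. U i (snd p) \<partial>P x)"
      using inc' by (rule ennreal_SUP_add)
    also have "(SUP i. \<integral>\<^sup>+p. U i (fst p) \<partial>P x) = (\<integral>\<^sup>+p. (SUP i. U i) (fst p) \<partial>P x)"
      unfolding SUP_apply using inc(1) by (intro nn_integral_monotone_convergence_SUP[symmetric]) auto
    also have "(SUP i. \<integral>\<^sup>+p. U i (snd p) \<partial>P x) = (\<integral>\<^sup>+p. (SUP i. U i) (snd p) \<partial>P x)"
      unfolding SUP_apply using inc(2) by (intro nn_integral_monotone_convergence_SUP[symmetric]) auto
    finally show ?case .
  qed
qed

text \<open>The nonnegative formula is applied to the positive and negative parts of
  \<open>f\<close>, encoded as \<open>ennreal (f x)\<close> and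
  \<open>ennreal (- f x)\<close>.\<close>

lemma integral_Qker:
  fixes f :: "'a::metric_space \<Rightarrow> real"
  assumes T: "T_transition P" and f: "f \<in> borel_measurable borel"
    and i: "integrable (P x) (\<lambda>p. f (fst p))" "integrable (P x) (\<lambda>p. f (snd p))"
  shows "integrable (Qker P x) f"
    "kernel_apply (Qker P) f x = ((\<integral>p. f (fst p) \<partial>P x) + (\<integral>p. f (snd p) \<partial>P x)) / 2"
proof -
  have m: "(\<lambda>x. ennreal (f x)) \<in> borel_measurable borel" "(\<lambda>x. ennreal (- f x)) \<in> borel_measurable borel"
    "(\<lambda>x. ennreal (norm (f x))) \<in> borel_measurable borel" "f \<in> borel_measurable (Qker P x)"
    using f by (auto simp: measurable_cong_sets[OF sets_Qker refl])
  note fin = integrableD[OF i(1)] integrableD[OF i(2)]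
  have "(\<integral>\<^sup>+y. ennreal (norm (f y)) \<partial>(Qker P x)) < \<infinity>"
    unfolding nn_integral_Qker[OF T m(3)] using i
    by (auto simp: integrable_iff_bounded less_top[symmetric] ennreal_divide_eq_top_iff)
  then show I: "integrable (Qker P x) f"
    using m by (intro integrableI_bounded) auto
  \<comment> \<open>\<open>enn2real\<close> sends infinity to 0, so it respects sums only for finite
    arguments; \<open>fin\<close> supplies the finiteness.\<close>
  have e: "enn2real ((a + b) / 2) = (enn2real a + enn2real b) / 2" if ab: "a \<noteq> \<infinity>" "b \<noteq> \<infinity>" for a b
  proof -
    obtain r s where rs: "a = ennreal r" "b = ennreal s" "0 \<le> r" "0 \<le> s"
      using ab by (cases a; cases b) auto
    then have "(a + b) / 2 = ennreal ((r + s) / 2)"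
      by (simp add: divide_ennreal[symmetric])
    then show ?thesis using rs by (simp del: ennreal_plus)
  qed
  show "kernel_apply (Qker P) f x = ((\<integral>p. f (fst p) \<partial>P x) + (\<integral>p. f (snd p) \<partial>P x)) / 2"
    unfolding kernel_apply_def real_lebesgue_integral_def[OF I] real_lebesgue_integral_def[OF i(1)]
      real_lebesgue_integral_def[OF i(2)] nn_integral_Qker[OF T m(1)] nn_integral_Qker[OF T m(2)]
    using fin by (simp add: e diff_divide_distrib add_divide_distrib)
qed

section \<open>Admissible spaces\<close>

locale admissible_space =
  fixes P :: "'a::metric_space \<Rightarrow> ('a \<times> 'a) measure" and \<nu> \<mu> :: "'a measure" and F :: "('a \<Rightarrow> real) set"
  assumes T: "T_transition P" and adm: "admissible P \<nu> \<mu> F"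
begin

text \<open>Iterating an operator on functions avoids integrals against iterated kernels;
  \<open>Qpow_eq\<close> shows that both agree on \<open>F\<close>.\<close>

definition Qop :: "('a \<Rightarrow> real) \<Rightarrow> 'a \<Rightarrow> real" where
  "Qop f = kernel_apply (Qker P) f"

lemma F_measurable: "f \<in> F \<Longrightarrow> f \<in> borel_measurable borel"
  and F_const: "(\<lambda>x. c) \<in> F"
  and F_add: "f \<in> F \<Longrightarrow> g \<in> F \<Longrightarrow> (\<lambda>x. f x + g x) \<in> F"
  and F_scale: "f \<in> F \<Longrightarrow> (\<lambda>x. c * f x) \<in> F"
  and F_square: "f \<in> F \<Longrightarrow> (\<lambda>x. (f x)\<^sup>2) \<in> F"
  and integrable_tensor: "f \<in> F \<Longrightarrow> g \<in> F \<Longrightarrow> integrable (P x) (tensor f g)"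
  and F_tensor: "f \<in> F \<Longrightarrow> g \<in> F \<Longrightarrow> kernel_apply P (tensor f g) \<in> F"
  and F_Qpow_bound: "f \<in> F \<Longrightarrow> \<exists>g\<in>F. \<forall>r x. \<bar>Qpow P r f x\<bar> \<le> g x"
  and F_integrable_init: "f \<in> F \<Longrightarrow> integrable \<nu> f"
  using adm by (auto simp: admissible_def function_subspace_def)

lemma F_diff: "f \<in> F \<Longrightarrow> g \<in> F \<Longrightarrow> (\<lambda>x. f x - g x) \<in> F"
  using F_add[OF _ F_scale[of g "-1"], of f] by simp

text \<open>
  Since \<open>\<bar>f\<bar>\<close> need not belong to \<open>F\<close>, this member of \<open>F\<close> replaces it in all domination arguments.
\<close>

definition majorant :: "('a \<Rightarrow> real) \<Rightarrow> 'a \<Rightarrow> real" where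
  "majorant f x = 1 + (f x)\<^sup>2"

lemma F_majorant: "f \<in> F \<Longrightarrow> majorant f \<in> F"
  unfolding majorant_def by (intro F_add F_const F_square)

lemma abs_le_majorant: "\<bar>f x\<bar> \<le> majorant f x"
proof -
  have "0 \<le> (\<bar>f x\<bar> - 1)\<^sup>2 + \<bar>f x\<bar>"
    by simp
  then show ?thesis
    unfolding majorant_def power2_diff by (simp add: power2_abs)
qed

lemma majorant_nonneg: "0 \<le> majorant f x"
  by (simp add: majorant_def)

text \<open>A function of one coordinate is a tensor with the constant 1, and constants belong to
  \<open>F\<close>.\<close>

lemma integrable_coord:
  assumes "f \<in> F"
  shows "integrable (P x) (\<lambda>p. f (fst p))" "integrable (P x) (\<lambda>p. f (snd p))"
  using integrable_tensor[OF assms F_const[of 1]] integrable_tensor[OF F_const[of 1] assms]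
  by (simp_all add: tensor_def case_prod_beta')

lemma integrable_Qker: "f \<in> F \<Longrightarrow> integrable (Qker P x) f"
  by (intro integral_Qker(1) T F_measurable integrable_coord)

text \<open>Writing both marginals as tensors with 1 is what keeps \<open>Qop\<close> inside
  \<open>F\<close>.\<close>

lemma Qop_eq:
  assumes "f \<in> F"
  shows "Qop f x = (kernel_apply P (tensor f (\<lambda>_. 1)) x + kernel_apply P (tensor (\<lambda>_. 1) f) x) / 2"
  using integral_Qker(2)[OF T F_measurable[OF assms] integrable_coord[OF assms]]
  by (simp add: Qop_def tensor_def case_prod_beta' kernel_apply_def)

lemma F_Qop:
  assumes "f \<in> F"
  shows "Qop f \<in> F"
proof -
  have "Qop f = (\<lambda>x. (1/2) * (kernel_apply P (tensor f (\<lambda>_. 1)) x + kernel_apply P (tensor (\<lambda>_. 1) f) x))"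
    using Qop_eq[OF assms] by auto
  also have "\<dots> \<in> F"
    by (intro F_scale F_add F_tensor F_const assms)
  finally show ?thesis .
qed

lemma F_Qop_iter: "f \<in> F \<Longrightarrow> (Qop ^^ r) f \<in> F"
  by (induction r) (auto intro: F_Qop)

text \<open>\<open>nn_integral_bind\<close> peels off one step of the kernel without integrability.
  Nonnegativity of the iterates is carried through the induction because it turns the remaining
  integral into \<open>ennreal\<close> of a real one; finiteness comes from
  \<open>F_Qop_iter\<close>.\<close>

lemma nn_integral_kernel_iter:
  assumes "u \<in> F" "\<And>x. 0 \<le> u x"
  shows "(\<integral>\<^sup>+y. u y \<partial>(kernel_iter (Qker P) r x)) = ennreal ((Qop ^^ r) u x) \<and> 0 \<le> (Qop ^^ r) u x"
proof (induction r arbitrary: x)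
  case 0
  have "(\<lambda>x. ennreal (u x)) \<in> borel_measurable borel"
    using F_measurable[OF assms(1)] by simp
  then show ?case
    using assms by (simp add: nn_integral_return)
next
  case (Suc r)
  have m: "(\<lambda>x. ennreal (u x)) \<in> borel_measurable borel"
    using F_measurable[OF assms(1)] by simp
  have k: "kernel_iter (Qker P) r \<in> Qker P x \<rightarrow>\<^sub>M subprob_algebra borel"
    using measurable_prob_algebraD[OF kernel_iter_measurable[OF Qker_measurable[OF T], of r]]
    by (simp add: measurable_cong_sets[OF sets_Qker refl])
  have "(\<integral>\<^sup>+y. u y \<partial>(kernel_iter (Qker P) (Suc r) x)) = (\<integral>\<^sup>+y. ennreal ((Qop ^^ r) u y) \<partial>Qker P x)"
    using nn_integral_bind[OF m k] Suc by simp
  also have "\<dots> = ennreal (\<integral>y. (Qop ^^ r) u y \<partial>Qker P x)"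
    using Suc by (intro nn_integral_eq_integral integrable_Qker F_Qop_iter assms) auto
  finally have *: "(\<integral>\<^sup>+y. u y \<partial>(kernel_iter (Qker P) (Suc r) x)) = ennreal (\<integral>y. (Qop ^^ r) u y \<partial>Qker P x)" .
  have "(Qop ^^ Suc r) u x = (\<integral>y. (Qop ^^ r) u y \<partial>Qker P x)"
    by (simp add: Qop_def[of "(Qop ^^ r) u"] kernel_apply_def)
  moreover have "0 \<le> (\<integral>y. (Qop ^^ r) u y \<partial>Qker P x)"
    using Suc by (intro integral_nonneg_AE) auto
  ultimately show ?case
    by (simp only: * refl simp_thms)
qed

lemma Qop_diff: "f \<in> F \<Longrightarrow> g \<in> F \<Longrightarrow> Qop (\<lambda>x. f x - g x) = (\<lambda>x. Qop f x - Qop g x)"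
  by (auto simp: Qop_def kernel_apply_def integrable_Qker)

lemma Qop_iter_diff:
  "f \<in> F \<Longrightarrow> g \<in> F \<Longrightarrow> (Qop ^^ r) (\<lambda>x. f x - g x) = (\<lambda>x. (Qop ^^ r) f x - (Qop ^^ r) g x)"
  by (induction r) (auto simp: Qop_diff F_Qop_iter)

text \<open>
  The integral defining \<open>Qpow\<close> would be \<open>0\<close> for a non-integrable function; integrability is obtained by
  writing \<open>f\<close> as a difference of two nonnegative members of \<open>F\<close>.
\<close>

lemma Qpow_eq:
  assumes "f \<in> F"
  shows "Qpow P r f = (Qop ^^ r) f"
proof
  fix x
  let ?K = "kernel_iter (Qker P) r x"
  have K: "sets ?K = sets borel"
    using measurable_space[OF kernel_iter_measurable[OF Qker_measurable[OF T], of r], of x]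
    by (simp add: space_prob_algebra)
  have pos: "integrable ?K u \<and> (\<integral>y. u y \<partial>?K) = (Qop ^^ r) u x" if "u \<in> F" "\<And>x. 0 \<le> u x" for u
  proof -
    have u: "u \<in> borel_measurable ?K"
      using F_measurable[OF that(1)] by (simp add: measurable_cong_sets[OF K refl])
    note n = nn_integral_kernel_iter[OF that, of r x]
    show ?thesis
      using n u that by (auto intro!: integrableI_nonneg simp: integral_eq_nn_integral)
  qed
  define g where "g = (\<lambda>x. majorant f x - f x)"
  have g: "g \<in> F" "\<And>x. 0 \<le> g x"
    using abs_le_majorant[of f] by (auto simp: g_def assms F_diff F_majorant abs_le_iff)
  have f: "f = (\<lambda>x. majorant f x - g x)"
    by (simp add: g_def)
  have "(\<integral>y. f y \<partial>?K) = (\<integral>y. majorant f y \<partial>?K) - (\<integral>y. g y \<partial>?K)"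
    using pos[OF g] pos[OF F_majorant[OF assms] majorant_nonneg] by (subst f) simp
  also have "\<dots> = (Qop ^^ r) f x"
    using pos[OF g] pos[OF F_majorant[OF assms] majorant_nonneg] Qop_iter_diff[OF F_majorant[OF assms] g(1), of r]
    by (simp flip: f)
  finally show "Qpow P r f x = (Qop ^^ r) f x"
    by (simp add: Qpow_def kernel_apply_def)
qed

lemma Qop_iter_bound:
  assumes "f \<in> F"
  obtains g where "g \<in> F" "\<And>r x. \<bar>(Qop ^^ r) f x\<bar> \<le> g x"
  using F_Qpow_bound[OF assms] by (auto simp: Qpow_eq[OF assms])

end

section \<open>The Markov property for functions in the admissible space\<close>

lemma generation_0: "generation 0 = {1}"
  by (auto simp: generation_def)

lemma finite_generation [simp]: "finite (generation q)"
  by (simp add: generation_def)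

lemma card_generation: "card (generation q) = 2 ^ q"
  by (simp add: generation_def)

text \<open>Excludes the index 0, at which \<open>X\<close> is unconstrained.\<close>

lemma generation_ge_1: "n \<in> generation q \<Longrightarrow> 1 \<le> n"
  using one_le_power[of "2::nat" q] by (auto simp: generation_def)

lemma sum_generation_Suc:
  fixes g :: "nat \<Rightarrow> 'b::comm_monoid_add"
  shows "(\<Sum>i\<in>generation (Suc q). g i) = (\<Sum>n\<in>generation q. g (2 * n) + g (2 * n + 1))"
proof -
  \<comment> \<open>Arbitrary endpoints are needed for the induction on \<open>b\<close>, which
    would not pass through powers of 2 only.\<close>
  have "(\<Sum>i\<in>{2 * a ..< 2 * b}. g i) = (\<Sum>n\<in>{a..<b}. g (2 * n) + g (2 * n + 1))" for a b :: nat
  proof (induction b)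
    case (Suc b)
    show ?case
    proof (cases "a \<le> b")
      case True
      then have "{2 * a ..< 2 * Suc b} = insert (2 * b + 1) (insert (2 * b) {2 * a ..< 2 * b})"
        "{a..<Suc b} = insert b {a..<b}"
        by auto
      then show ?thesis
        using Suc by (simp add: ac_simps)
    qed auto
  qed simp
  from this[of "2 ^ q" "2 ^ (q + 1)"] show ?thesis
    by (simp add: generation_def)
qed

lemma generation_Suc_cases:
  assumes "i \<in> generation (Suc q)"
  obtains n where "n \<in> generation q" "i = 2 * n \<or> i = 2 * n + 1"
proof
  show "i div 2 \<in> generation q" "i = 2 * (i div 2) \<or> i = 2 * (i div 2) + 1"
    using assms by (auto simp: generation_def)
qed

text \<open>Truncation at level \<open>k\<close>. The Markov property is given for bounded functions
  only; clipped functions are bounded, keep every majorant of the absolute value, and keep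
  nonnegativity.\<close>

definition clip :: "nat \<Rightarrow> real \<Rightarrow> real" where
  "clip k y = max (- real k) (min (real k) y)"

lemma abs_clip_le: "\<bar>clip k y\<bar> \<le> \<bar>y\<bar>" "\<bar>clip k y\<bar> \<le> real k"
  by (auto simp: clip_def)

lemma clip_tendsto: "(\<lambda>k. clip k y) \<longlonglongrightarrow> y"
proof (rule tendsto_eventually)
  obtain N where "\<bar>y\<bar> \<le> real N"
    using real_arch_simple by blast
  then show "\<forall>\<^sub>F k in sequentially. clip k y = y"
    by (intro eventually_sequentiallyI[of N]) (auto simp: clip_def)
qed

lemma clip_measurable [measurable]: "clip k \<in> borel_measurable borel"
  unfolding clip_def by measurable

lemma clip_nonneg: "0 \<le> y \<Longrightarrow> 0 \<le> clip k y"
  by (simp add: clip_def)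

section \<open>Replacing expectations over daughters by expectations over mothers\<close>

locale admissible_bmc = admissible_space P \<nu> \<mu> F
  for P :: "'a::metric_space \<Rightarrow> ('a \<times> 'a) measure" and \<nu> \<mu> F +
  fixes M :: "'w measure" and Fil X
  assumes bmc: "bifurcating_markov_chain M Fil X \<nu> P"
begin

sublocale prob_space M
  using bmc by (auto simp: bifurcating_markov_chain_def filtered_prob_space_def)

abbreviation daughters :: "nat \<Rightarrow> 'w \<Rightarrow> 'a \<times> 'a" where
  "daughters n \<omega> \<equiv> (X (2 * n) \<omega>, X (2 * n + 1) \<omega>)"

lemma X_measurable: "1 \<le> n \<Longrightarrow> X n \<in> M \<rightarrow>\<^sub>M borel"
  using bmc by (auto simp: bifurcating_markov_chain_def filtered_prob_space_def
      intro: measurable_from_subalg)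

lemma daughters_measurable: "1 \<le> n \<Longrightarrow> daughters n \<in> M \<rightarrow>\<^sub>M borel \<Otimes>\<^sub>M borel"
  by (intro measurable_Pair X_measurable) auto

lemma borel_measurable_daughters:
  "1 \<le> n \<Longrightarrow> \<psi> \<in> borel_measurable (borel \<Otimes>\<^sub>M borel) \<Longrightarrow> (\<lambda>\<omega>. \<psi> (daughters n \<omega>)) \<in> borel_measurable M"
  by (rule measurable_compose[OF daughters_measurable])

lemma borel_measurable_kernel_apply:
  "1 \<le> n \<Longrightarrow> \<psi> \<in> borel_measurable (borel \<Otimes>\<^sub>M borel) \<Longrightarrow> (\<lambda>\<omega>. kernel_apply P \<psi> (X n \<omega>)) \<in> borel_measurable M"
  by (intro measurable_compose[OF X_measurable] kernel_apply_measurable[OF T_transitionD(4)[OF T]])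

text \<open>The Markov property is used with \<open>\<phi>\<close> on \<open>A\<close> and 1 on the
  rest of the generation. Since \<open>P\<close> maps 1 to 1, both products reduce to
  \<open>A\<close>; taking expectations removes the conditioning.\<close>

lemma expectation_prod_bounded:
  assumes A: "A \<subseteq> generation q"
    and \<phi>: "\<phi> \<in> borel_measurable (borel \<Otimes>\<^sub>M borel)" "\<And>p. \<bar>\<phi> p\<bar> \<le> B"
  shows "expectation (\<lambda>\<omega>. \<Prod>n\<in>A. \<phi> (daughters n \<omega>)) = expectation (\<lambda>\<omega>. \<Prod>n\<in>A. kernel_apply P \<phi> (X n \<omega>))"
proof -
  have cond: "\<forall>n\<in>generation q. f n \<in> borel_measurable (borel \<Otimes>\<^sub>M borel) \<and> bounded (range (f n)) \<Longrightarrow>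
      AE \<omega> in M. real_cond_exp M (Fil q) (\<lambda>\<omega>. \<Prod>n\<in>generation q. f n (daughters n \<omega>)) \<omega> =
        (\<Prod>n\<in>generation q. kernel_apply P (f n) (X n \<omega>))" for q and f :: "nat \<Rightarrow> 'a \<times> 'a \<Rightarrow> real"
    using bmc unfolding bifurcating_markov_chain_def by simp
  let ?f = "\<lambda>n. if n \<in> A then \<phi> else (\<lambda>_. 1)"
  have sub: "subalgebra M (Fil q)"
    using bmc by (auto simp: bifurcating_markov_chain_def filtered_prob_space_def)
  interpret C: sigma_finite_subalgebra M "Fil q"
    by (intro finite_measure_subalgebra_is_sigma_finite finite_measure_subalgebra.intro
        finite_measure_axioms finite_measure_subalgebra_axioms.intro sub)
  have "finite A"
    using finite_subset[OF A] by simp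
  have one: "kernel_apply P (\<lambda>_. 1) x = 1" for x
    using prob_space.prob_space[OF T_transitionD(1)[OF T, of x]] by (simp add: kernel_apply_def)
  have prods: "(\<Prod>n\<in>generation q. ?f n (daughters n \<omega>)) = (\<Prod>n\<in>A. \<phi> (daughters n \<omega>))"
    "(\<Prod>n\<in>generation q. kernel_apply P (?f n) (X n \<omega>)) = (\<Prod>n\<in>A. kernel_apply P \<phi> (X n \<omega>))" for \<omega>
    by (intro prod.mono_neutral_cong_right; use A one in auto)+
  have "\<forall>n\<in>generation q. ?f n \<in> borel_measurable (borel \<Otimes>\<^sub>M borel) \<and> bounded (range (?f n))"
    using \<phi> by (auto simp: bounded_iff)
  then have AE: "AE \<omega> in M. real_cond_exp M (Fil q) (\<lambda>\<omega>. \<Prod>n\<in>A. \<phi> (daughters n \<omega>)) \<omega> =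
      (\<Prod>n\<in>A. kernel_apply P \<phi> (X n \<omega>))"
    using cond[of q ?f] unfolding prods by blast
  have m: "n \<in> A \<Longrightarrow> (\<lambda>\<omega>. \<phi> (daughters n \<omega>)) \<in> borel_measurable M"
    "n \<in> A \<Longrightarrow> (\<lambda>\<omega>. kernel_apply P \<phi> (X n \<omega>)) \<in> borel_measurable M" for n
    using borel_measurable_daughters[OF _ \<phi>(1)] borel_measurable_kernel_apply[OF _ \<phi>(1)] A generation_ge_1
    by blast+
  have "integrable M (\<lambda>\<omega>. \<Prod>n\<in>A. \<phi> (daughters n \<omega>))"
  proof (rule integrable_const_bound)
    show "AE \<omega> in M. norm (\<Prod>n\<in>A. \<phi> (daughters n \<omega>)) \<le> (\<Prod>n\<in>A. B)"
      using \<phi>(2) by (auto simp: abs_prod simp del: prod_constant intro!: AE_I2 prod_mono)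
  qed (use m in auto)
  then have "expectation (\<lambda>\<omega>. \<Prod>n\<in>A. \<phi> (daughters n \<omega>)) =
      expectation (real_cond_exp M (Fil q) (\<lambda>\<omega>. \<Prod>n\<in>A. \<phi> (daughters n \<omega>)))"
    by (rule C.real_cond_exp_int(2)[symmetric])
  also have "\<dots> = expectation (\<lambda>\<omega>. \<Prod>n\<in>A. kernel_apply P \<phi> (X n \<omega>))"
    using AE m by (intro integral_cong_AE) (auto intro: measurable_from_subalg[OF sub])
  finally show ?thesis .
qed

text \<open>Dominated convergence under \<open>P x\<close>. The bound does not depend on
  \<open>k\<close>, so it serves as the dominating function in the later limit under
  \<open>M\<close>.\<close>

lemma kernel_apply_clip:
  assumes \<phi>: "\<phi> \<in> borel_measurable (borel \<Otimes>\<^sub>M borel)" "\<And>p. \<bar>\<phi> p\<bar> \<le> w p" and w: "\<And>x. integrable (P x) w"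
  shows "(\<lambda>k. kernel_apply P (\<lambda>p. clip k (\<phi> p)) x) \<longlonglongrightarrow> kernel_apply P \<phi> x"
    "\<bar>kernel_apply P (\<lambda>p. clip k (\<phi> p)) x\<bar> \<le> kernel_apply P w x"
proof -
  have m: "\<phi> \<in> borel_measurable (P x)" "(\<lambda>p. clip k (\<phi> p)) \<in> borel_measurable (P x)" for k
    using \<phi>(1) by (auto simp: measurable_cong_sets[OF T_transitionD(2)[OF T] refl])
  have b: "\<bar>clip k (\<phi> p)\<bar> \<le> w p" for k p
    using abs_clip_le(1)[of k "\<phi> p"] \<phi>(2)[of p] by linarith
  show "(\<lambda>k. kernel_apply P (\<lambda>p. clip k (\<phi> p)) x) \<longlonglongrightarrow> kernel_apply P \<phi> x"
    unfolding kernel_apply_def using w[of x] m b clip_tendsto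
    by (intro integral_dominated_convergence[where w = w]) auto
  show "\<bar>kernel_apply P (\<lambda>p. clip k (\<phi> p)) x\<bar> \<le> kernel_apply P w x"
    unfolding kernel_apply_def using m b
    by (intro order_trans[OF integral_abs_bound integral_mono] w integrable_abs
        Bochner_Integration.integrable_bound[OF w[of x]])
      (auto intro: order_trans[OF b abs_ge_self])
qed

text \<open>Truncation followed by dominated convergence on both sides. The left side is dominated
  through \<open>w\<close> at the daughters and the right side through
  \<open>kernel_apply P w\<close> at the mothers, whence the two parts of
  \<open>int\<close>.\<close>

lemma expectation_prod:
  assumes A: "A \<subseteq> generation q"
    and \<phi>: "\<phi> \<in> borel_measurable (borel \<Otimes>\<^sub>M borel)" "\<And>p. \<bar>\<phi> p\<bar> \<le> w p" and w: "\<And>x. integrable (P x) w"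
    and int: "integrable M (\<lambda>\<omega>. \<Prod>n\<in>A. w (daughters n \<omega>))" "integrable M (\<lambda>\<omega>. \<Prod>n\<in>A. kernel_apply P w (X n \<omega>))"
  shows "expectation (\<lambda>\<omega>. \<Prod>n\<in>A. \<phi> (daughters n \<omega>)) = expectation (\<lambda>\<omega>. \<Prod>n\<in>A. kernel_apply P \<phi> (X n \<omega>))"
proof -
  let ?\<phi> = "\<lambda>k p. clip k (\<phi> p)"
  have "finite A"
    using finite_subset[OF A] by simp
  have \<phi>k: "?\<phi> k \<in> borel_measurable (borel \<Otimes>\<^sub>M borel)" for k
    using \<phi>(1) by measurable
  have m: "n \<in> A \<Longrightarrow> (\<lambda>\<omega>. \<psi> (daughters n \<omega>)) \<in> borel_measurable M"
    "n \<in> A \<Longrightarrow> (\<lambda>\<omega>. kernel_apply P \<psi> (X n \<omega>)) \<in> borel_measurable M"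
    if "\<psi> \<in> borel_measurable (borel \<Otimes>\<^sub>M borel)" for n \<psi>
    using borel_measurable_daughters[OF _ that] borel_measurable_kernel_apply[OF _ that] A generation_ge_1
    by blast+
  have b: "\<bar>?\<phi> k p\<bar> \<le> w p" for k p
    using abs_clip_le(1)[of k "\<phi> p"] \<phi>(2)[of p] by linarith
  have "(\<lambda>k. expectation (\<lambda>\<omega>. \<Prod>n\<in>A. ?\<phi> k (daughters n \<omega>))) \<longlonglongrightarrow> expectation (\<lambda>\<omega>. \<Prod>n\<in>A. \<phi> (daughters n \<omega>))"
  proof (rule integral_dominated_convergence[OF _ _ int(1)])
    show "AE \<omega> in M. norm (\<Prod>n\<in>A. ?\<phi> k (daughters n \<omega>)) \<le> (\<Prod>n\<in>A. w (daughters n \<omega>))" for k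
      using b by (auto simp: abs_prod intro!: prod_mono)
  qed (use m \<phi> \<phi>k in \<open>auto intro!: borel_measurable_prod tendsto_prod clip_tendsto\<close>)
  moreover have "(\<lambda>k. expectation (\<lambda>\<omega>. \<Prod>n\<in>A. kernel_apply P (?\<phi> k) (X n \<omega>))) \<longlonglongrightarrow>
      expectation (\<lambda>\<omega>. \<Prod>n\<in>A. kernel_apply P \<phi> (X n \<omega>))"
  proof (rule integral_dominated_convergence[OF _ _ int(2)])
    show "AE \<omega> in M. norm (\<Prod>n\<in>A. kernel_apply P (?\<phi> k) (X n \<omega>)) \<le> (\<Prod>n\<in>A. kernel_apply P w (X n \<omega>))" for k
      using kernel_apply_clip(2)[OF \<phi> w] by (auto simp: abs_prod intro!: prod_mono)
  qed (use m \<phi> \<phi>k in \<open>auto intro!: borel_measurable_prod tendsto_prod kernel_apply_clip(1)[OF \<phi> w]\<close>)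
  moreover have "expectation (\<lambda>\<omega>. \<Prod>n\<in>A. ?\<phi> k (daughters n \<omega>)) =
      expectation (\<lambda>\<omega>. \<Prod>n\<in>A. kernel_apply P (?\<phi> k) (X n \<omega>))" for k
    using A \<phi>k abs_clip_le(2) by (rule expectation_prod_bounded)
  ultimately show ?thesis
    using LIMSEQ_unique by simp
qed

text \<open>\<open>expectation_prod\<close> presupposes integrability at the daughters and cannot
  supply it. Fatou's lemma along the truncations does, because their expectations are bounded by
  that of \<open>kernel_apply P \<phi> (X n \<omega>)\<close>.\<close>

lemma integrable_daughters:
  assumes n: "n \<in> generation q"
    and \<phi>: "\<phi> \<in> borel_measurable (borel \<Otimes>\<^sub>M borel)" "\<And>p. 0 \<le> \<phi> p" "\<And>x. integrable (P x) \<phi>"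
    and int: "integrable M (\<lambda>\<omega>. kernel_apply P \<phi> (X n \<omega>))"
  shows "integrable M (\<lambda>\<omega>. \<phi> (daughters n \<omega>))"
proof -
  let ?\<phi> = "\<lambda>k p. clip k (\<phi> p)"
  let ?C = "ennreal (expectation (\<lambda>\<omega>. kernel_apply P \<phi> (X n \<omega>)))"
  have \<phi>k: "?\<phi> k \<in> borel_measurable (borel \<Otimes>\<^sub>M borel)" for k
    using \<phi>(1) by measurable
  have m: "(\<lambda>\<omega>. \<psi> (daughters n \<omega>)) \<in> borel_measurable M"
    "(\<lambda>\<omega>. kernel_apply P \<psi> (X n \<omega>)) \<in> borel_measurable M"
    if "\<psi> \<in> borel_measurable (borel \<Otimes>\<^sub>M borel)" for \<psi>
    using borel_measurable_daughters[OF _ that] borel_measurable_kernel_apply[OF _ that] n generation_ge_1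
    by blast+
  have abs: "\<bar>\<phi> p\<bar> \<le> \<phi> p" for p
    using \<phi>(2)[of p] by simp
  have le: "(\<integral>\<^sup>+\<omega>. ?\<phi> k (daughters n \<omega>) \<partial>M) \<le> ?C" for k
  proof -
    have "integrable M (\<lambda>\<omega>. ?\<phi> k (daughters n \<omega>))"
      using abs_clip_le(2) m(1)[OF \<phi>k] by (intro integrable_const_bound[where B = "real k"]) auto
    then have "(\<integral>\<^sup>+\<omega>. ?\<phi> k (daughters n \<omega>) \<partial>M) = ennreal (expectation (\<lambda>\<omega>. ?\<phi> k (daughters n \<omega>)))"
      using clip_nonneg \<phi>(2) by (intro nn_integral_eq_integral) auto
    also have "expectation (\<lambda>\<omega>. ?\<phi> k (daughters n \<omega>)) = expectation (\<lambda>\<omega>. kernel_apply P (?\<phi> k) (X n \<omega>))"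
      using expectation_prod_bounded[of "{n}" q "?\<phi> k" "real k"] n \<phi>k abs_clip_le(2) by simp
    also have "\<dots> \<le> expectation (\<lambda>\<omega>. kernel_apply P \<phi> (X n \<omega>))"
    proof (rule integral_mono_AE)
      have *: "\<bar>kernel_apply P (?\<phi> k) x\<bar> \<le> kernel_apply P \<phi> x" for x
        by (rule kernel_apply_clip(2)[OF \<phi>(1) abs \<phi>(3)])
      then show "integrable M (\<lambda>\<omega>. kernel_apply P (?\<phi> k) (X n \<omega>))"
        using m(2)[OF \<phi>k] by (intro Bochner_Integration.integrable_bound[OF int])
          (auto intro: order_trans[OF * abs_ge_self])
      show "AE \<omega> in M. kernel_apply P (?\<phi> k) (X n \<omega>) \<le> kernel_apply P \<phi> (X n \<omega>)"
        using * by (auto simp: abs_le_iff)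
    qed (rule int)
    finally show ?thesis
      by (simp add: ennreal_leI)
  qed
  have "(\<integral>\<^sup>+\<omega>. \<phi> (daughters n \<omega>) \<partial>M) = (\<integral>\<^sup>+\<omega>. liminf (\<lambda>k. ennreal (?\<phi> k (daughters n \<omega>))) \<partial>M)"
    by (intro nn_integral_cong lim_imp_Liminf[symmetric] tendsto_ennrealI clip_tendsto) auto
  also have "\<dots> \<le> liminf (\<lambda>k. \<integral>\<^sup>+\<omega>. ?\<phi> k (daughters n \<omega>) \<partial>M)"
    using m(1)[OF \<phi>k] by (intro nn_integral_liminf) auto
  also have "\<dots> \<le> ?C"
    using le by (intro Liminf_le) auto
  finally have "(\<integral>\<^sup>+\<omega>. \<phi> (daughters n \<omega>) \<partial>M) < \<infinity>"
    using ennreal_less_top order.strict_trans1 by (metis infinity_ennreal_def)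
  then show ?thesis
    using m(1)[OF \<phi>(1)] \<phi>(2) by (intro integrableI_nonneg) auto
qed

lemma tensor_measurable: "f \<in> F \<Longrightarrow> g \<in> F \<Longrightarrow> tensor f g \<in> borel_measurable (borel \<Otimes>\<^sub>M borel)"
  using F_measurable[of f] F_measurable[of g] unfolding tensor_def by measurable

text \<open>Induction on the generation, with the function free in \<open>F\<close>. It starts from
  integrability under \<open>\<nu>\<close>; a daughter is reduced to her mother because
  \<open>P\<close> sends tensors of members of \<open>F\<close> back into \<open>F\<close>.\<close>

lemma integrable_X:
  assumes "n \<in> generation q" "f \<in> F"
  shows "integrable M (\<lambda>\<omega>. f (X n \<omega>))"
  using assms
proof (induction q arbitrary: n f)
  case 0
  then have "n = 1"
    by (simp add: generation_0)
  moreover have "distr M borel (X 1) = \<nu>"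
    using bmc by (simp add: bifurcating_markov_chain_def)
  ultimately show ?case
    using F_integrable_init[OF 0(2)] integrable_distr_eq[OF X_measurable F_measurable[OF 0(2)], of 1] by simp
next
  case (Suc q)
  from Suc.prems(1) obtain m where m: "m \<in> generation q" "n = 2 * m \<or> n = 2 * m + 1"
    by (rule generation_Suc_cases)
  \<comment> \<open>\<open>integrable_daughters\<close> treats nonnegative functions, so the claim
    is first shown for the majorant, tensored with 1 on the side of the other sister.\<close>
  let ?u = "majorant f"
  have u: "?u \<in> F"
    using Suc.prems(2) by (rule F_majorant)
  have *: "integrable M (\<lambda>\<omega>. tensor g h (daughters m \<omega>))"
    if "g \<in> F" "h \<in> F" "\<And>p. 0 \<le> tensor g h p" for g h
    by (rule integrable_daughters[OF m(1)])
      (intro tensor_measurable integrable_tensor Suc.IH[OF m(1)] F_tensor that)+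
  have "integrable M (\<lambda>\<omega>. ?u (X n \<omega>))"
    using *[OF u F_const[of 1]] *[OF F_const[of 1] u] m(2) majorant_nonneg by (auto simp: tensor_def)
  then show ?case
    using generation_ge_1[OF Suc.prems(1)] abs_le_majorant[of f] majorant_nonneg[of f]
    by (elim Bochner_Integration.integrable_bound)
      (auto intro!: measurable_compose[OF X_measurable] F_measurable Suc.prems)
qed

text \<open>A product is dominated by the sum of the squares, and \<open>F\<close> is closed under
  squaring.\<close>

lemma integrable_X_mult:
  assumes "n \<in> generation q" "m \<in> generation q'" "f \<in> F" "g \<in> F"
  shows "integrable M (\<lambda>\<omega>. f (X n \<omega>) * g (X m \<omega>))"
proof (rule Bochner_Integration.integrable_bound)
  show "integrable M (\<lambda>\<omega>. (f (X n \<omega>))\<^sup>2 + (g (X m \<omega>))\<^sup>2)"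
    using assms by (intro Bochner_Integration.integrable_add integrable_X[OF _ F_square])
  show "(\<lambda>\<omega>. f (X n \<omega>) * g (X m \<omega>)) \<in> borel_measurable M"
    using assms generation_ge_1
    by (intro borel_measurable_times measurable_compose[OF X_measurable] F_measurable)
  have "\<bar>a * b\<bar> \<le> a\<^sup>2 + b\<^sup>2" for a b :: real
    using sum_squares_bound[of "\<bar>a\<bar>" "\<bar>b\<bar>"] abs_ge_zero[of "a * b"]
    unfolding abs_mult power2_abs by linarith
  then show "AE \<omega> in M. norm (f (X n \<omega>) * g (X m \<omega>)) \<le> norm ((f (X n \<omega>))\<^sup>2 + (g (X m \<omega>))\<^sup>2)"
    by simp
qed

lemma daughters_in_generation:
  "n \<in> generation q \<Longrightarrow> 2 * n \<in> generation (Suc q) \<and> 2 * n + 1 \<in> generation (Suc q)"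
  by (auto simp: generation_def)

text \<open>Sisters may be dependent given their mother, so their product is handled as one function
  of the pair, with the single mother \<open>n\<close> as index set.\<close>

lemma expectation_tensor:
  assumes n: "n \<in> generation q" and f: "f \<in> F" and g: "g \<in> F"
  shows "expectation (\<lambda>\<omega>. f (X (2 * n) \<omega>) * g (X (2 * n + 1) \<omega>)) =
    expectation (\<lambda>\<omega>. kernel_apply P (tensor f g) (X n \<omega>))"
proof -
  let ?w = "tensor (majorant f) (majorant g)"
  have "expectation (\<lambda>\<omega>. \<Prod>i\<in>{n}. tensor f g (daughters i \<omega>)) =
    expectation (\<lambda>\<omega>. \<Prod>i\<in>{n}. kernel_apply P (tensor f g) (X i \<omega>))"
  proof (rule expectation_prod[of "{n}" q "tensor f g" ?w])
    show "\<bar>tensor f g p\<bar> \<le> ?w p" for p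
      using abs_le_majorant by (auto simp: tensor_def abs_mult split: prod.split intro!: mult_mono majorant_nonneg)
    show "integrable M (\<lambda>\<omega>. \<Prod>i\<in>{n}. ?w (daughters i \<omega>))"
      using integrable_X_mult[of "2 * n" "Suc q" "2 * n + 1" "Suc q"] daughters_in_generation[OF n]
        F_majorant[OF f] F_majorant[OF g] by (simp add: tensor_def)
    show "integrable M (\<lambda>\<omega>. \<Prod>i\<in>{n}. kernel_apply P ?w (X i \<omega>))"
      using integrable_X[OF n F_tensor[OF F_majorant[OF f] F_majorant[OF g]]] by simp
  qed (use n f g in \<open>auto intro: tensor_measurable integrable_tensor F_majorant\<close>)
  then show ?thesis
    by (simp add: tensor_def)
qed

lemma kernel_apply_plus:
  assumes "f \<in> F"
  shows "integrable (P x) (\<lambda>p. f (fst p) + f (snd p))"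
    "kernel_apply P (\<lambda>p. f (fst p) + f (snd p)) = (\<lambda>x. 2 * Qop f x)"
  using integrable_coord[OF assms] Qop_eq[OF assms]
  by (simp_all add: fun_eq_iff kernel_apply_def tensor_def case_prod_beta' mult.commute)

text \<open>The Markov property over \<open>{n, m}\<close> factorizes over the two mothers; as these
  differ, the product over the set has two factors. Each sum over sisters becomes
  \<open>2 * Qop f\<close>, whence the factor 4.\<close>

lemma expectation_prod_plus:
  assumes n: "n \<in> generation q" "m \<in> generation q" "n \<noteq> m" and f: "f \<in> F"
  shows "expectation (\<lambda>\<omega>. (f (X (2 * n) \<omega>) + f (X (2 * n + 1) \<omega>)) * (f (X (2 * m) \<omega>) + f (X (2 * m + 1) \<omega>))) =
    4 * expectation (\<lambda>\<omega>. Qop f (X n \<omega>) * Qop f (X m \<omega>))"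
proof -
  let ?\<phi> = "\<lambda>p. f (fst p) + f (snd p)"
  let ?w = "\<lambda>p. majorant f (fst p) + majorant f (snd p)"
  note [measurable] = F_measurable[OF f]
  have "expectation (\<lambda>\<omega>. \<Prod>i\<in>{n,m}. ?\<phi> (daughters i \<omega>)) =
    expectation (\<lambda>\<omega>. \<Prod>i\<in>{n,m}. kernel_apply P ?\<phi> (X i \<omega>))"
  proof (rule expectation_prod[of "{n,m}" q ?\<phi> ?w])
    show "\<bar>?\<phi> p\<bar> \<le> ?w p" for p
      using abs_le_majorant[of f "fst p"] abs_le_majorant[of f "snd p"] by linarith
    show "integrable M (\<lambda>\<omega>. \<Prod>i\<in>{n,m}. ?w (daughters i \<omega>))"
      using n daughters_in_generation[OF n(1)] daughters_in_generation[OF n(2)]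
      by (simp add: distrib_left distrib_right)
        (intro Bochner_Integration.integrable_add integrable_X_mult[of _ "Suc q" _ "Suc q"] F_majorant f; simp)
    show "integrable M (\<lambda>\<omega>. \<Prod>i\<in>{n,m}. kernel_apply P ?w (X i \<omega>))"
      using n integrable_X_mult[OF n(1,2) F_Qop F_Qop, OF F_majorant F_majorant, OF f f]
      by (simp add: kernel_apply_plus F_majorant f ac_simps)
  qed (use n f kernel_apply_plus F_majorant in auto)
  then show ?thesis
    using n by (simp add: kernel_apply_plus f ac_simps mult.assoc[of 2 2])
qed

end

section \<open>Summability of the second moments\<close>

text \<open>The series of squares has finite expectation, hence is almost surely finite, and its
  terms tend to 0.\<close>

lemma AE_tendsto_zero_of_summable_second_moments:
  fixes Y :: "nat \<Rightarrow> 'b \<Rightarrow> real"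
  assumes "\<And>q. Y q \<in> borel_measurable M" "\<And>q. integrable M (\<lambda>\<omega>. (Y q \<omega>)\<^sup>2)"
    and "summable (\<lambda>q. \<integral>\<omega>. (Y q \<omega>)\<^sup>2 \<partial>M)"
  shows "AE \<omega> in M. (\<lambda>q. Y q \<omega>) \<longlonglongrightarrow> 0"
proof -
  note [measurable] = assms(1)
  have "(\<integral>\<^sup>+\<omega>. (\<Sum>q. ennreal ((Y q \<omega>)\<^sup>2)) \<partial>M) = (\<Sum>q. \<integral>\<^sup>+\<omega>. ennreal ((Y q \<omega>)\<^sup>2) \<partial>M)"
    by (rule nn_integral_suminf) measurable
  also have "\<dots> = (\<Sum>q. ennreal (\<integral>\<omega>. (Y q \<omega>)\<^sup>2 \<partial>M))"
    by (intro suminf_cong nn_integral_eq_integral assms) simp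
  also have "\<dots> = ennreal (\<Sum>q. \<integral>\<omega>. (Y q \<omega>)\<^sup>2 \<partial>M)"
    by (intro suminf_ennreal2 assms) simp
  finally have "AE \<omega> in M. (\<Sum>q. ennreal ((Y q \<omega>)\<^sup>2)) \<noteq> \<infinity>"
    by (intro nn_integral_noteq_infinite) simp_all
  then show ?thesis
  proof eventually_elim
    fix \<omega> assume "(\<Sum>q. ennreal ((Y q \<omega>)\<^sup>2)) \<noteq> \<infinity>"
    then have "summable (\<lambda>q. (Y q \<omega>)\<^sup>2)"
      by (intro summable_suminf_not_top) simp_all
    then have "(\<lambda>q. (Y q \<omega>)\<^sup>2) \<longlonglongrightarrow> 0"
      by (rule summable_LIMSEQ_zero)
    then have "(\<lambda>q. sqrt ((Y q \<omega>)\<^sup>2)) \<longlonglongrightarrow> sqrt 0"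
      by (rule tendsto_real_sqrt)
    then show "(\<lambda>q. Y q \<omega>) \<longlonglongrightarrow> 0"
      by (simp add: tendsto_rabs_zero_iff)
  qed
qed

text \<open>With nonnegative terms, the triangle \<open>r + s < N\<close> may be enlarged to a
  square, where summing over \<open>r\<close> first leaves at most \<open>c s\<close>.\<close>

lemma summable_diagonal:
  fixes b :: "nat \<Rightarrow> nat \<Rightarrow> real"
  assumes "\<And>s r. 0 \<le> b s r" "\<And>s R. (\<Sum>r<R. b s r) \<le> c s" "summable c"
  shows "summable (\<lambda>q. \<Sum>r\<le>q. b (q - r) r)"
proof (rule summableI_nonneg_bounded)
  have c: "0 \<le> c s" for s
    using assms(2)[of s 0] by simp
  fix N
  have "(\<Sum>q<N. \<Sum>r\<le>q. b (q - r) r) = (\<Sum>(r,s)\<in>{(i,j). i + j < N}. b s r)"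
    by (rule sum.triangle_reindex[symmetric])
  also have "\<dots> \<le> (\<Sum>(r,s)\<in>{..<N} \<times> {..<N}. b s r)"
    using assms(1) by (intro sum_mono2) auto
  also have "\<dots> = (\<Sum>s<N. \<Sum>r<N. b s r)"
    unfolding sum.cartesian_product[symmetric] by (rule sum.swap)
  also have "\<dots> \<le> (\<Sum>s<N. c s)"
    by (intro sum_mono assms)
  also have "\<dots> \<le> suminf c"
    using assms(3) c by (intro sum_le_suminf) auto
  finally show "(\<Sum>q<N. \<Sum>r\<le>q. b (q - r) r) \<le> suminf c" .
qed (simp add: assms(1) sum_nonneg)

section \<open>From averages over generations to averages over trees\<close>

lemma card_tree_upto: "real (card (tree_upto r)) = 2 ^ (r + 1) - 1"
  and sum_tree_upto: "(\<Sum>i\<in>tree_upto r. g i) = (\<Sum>q\<le>r. \<Sum>i\<in>generation q. g i :: real)"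
proof -
  have "generation p \<inter> generation q = {}" if "p < q" for p q
  proof -
    have "(2::nat) ^ (p + 1) \<le> 2 ^ q"
      using that by (intro power_increasing) auto
    then show ?thesis
      by (auto simp: generation_def)
  qed
  then have "generation p \<inter> generation q = {}" if "p \<noteq> q" for p q
    using that by (metis Int_commute nat_neq_iff)
  then have *: "(\<Sum>i\<in>tree_upto r. g i) = (\<Sum>q\<le>r. \<Sum>i\<in>generation q. g i)" for g :: "nat \<Rightarrow> real"
    unfolding tree_upto_def atLeast0AtMost by (intro sum.UNION_disjoint) auto
  then show "(\<Sum>i\<in>tree_upto r. g i) = (\<Sum>q\<le>r. \<Sum>i\<in>generation q. g i)" .
  show "real (card (tree_upto r)) = 2 ^ (r + 1) - 1"
    using *[of "\<lambda>_. 1"] sum_gp_strict[of "2::real" "Suc r"]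
    by (simp add: card_generation flip: lessThan_Suc_atMost del: sum.lessThan_Suc)
qed

text \<open>Generation \<open>r - k\<close> has weight at most \<open>(1/2) ^ k\<close> in the tree
  average. These weights are summable and each fixed \<open>k\<close> contributes a null sequence,
  so Tannery's theorem applies.\<close>

lemma average_tree_tendsto:
  assumes "(\<lambda>q. average X (generation q) f \<omega>) \<longlonglongrightarrow> 0"
  shows "(\<lambda>r. average X (tree_upto r) f \<omega>) \<longlonglongrightarrow> 0"
proof -
  define a where "a q = average X (generation q) f \<omega>" for q
  have a: "a \<longlonglongrightarrow> 0"
    using assms by (simp add: a_def[abs_def])
  have eq: "average X (tree_upto r) f \<omega> = (\<Sum>q\<le>r. 2 ^ q * a q) / (2 ^ (r + 1) - 1)" for r
    by (simp add: average_def sum_tree_upto card_tree_upto a_def card_generation)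
  have pow: "(2::real) ^ r \<le> 2 ^ (r + 1) - 1" for r
    using one_le_power[of "2::real" r] by simp
  have pos: "(0::real) < 2 ^ (r + 1) - 1" for r
    using pow[of r] zero_less_power[of "2::real" r] by linarith
  have le: "\<bar>average X (tree_upto r) f \<omega>\<bar> \<le> (\<Sum>k\<le>r. (1/2) ^ k * \<bar>a (r - k)\<bar>)" for r
  proof -
    have "\<bar>average X (tree_upto r) f \<omega>\<bar> = \<bar>\<Sum>q\<le>r. 2 ^ q * a q\<bar> / (2 ^ (r + 1) - 1)"
      unfolding eq abs_divide
      using abs_of_nonneg[OF order_trans[OF zero_le_power pow, of r]] by simp
    also have "\<dots> \<le> \<bar>\<Sum>q\<le>r. 2 ^ q * a q\<bar> / 2 ^ r"
      using pow[of r] pos[of r] by (intro divide_left_mono mult_pos_pos) simp_all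
    also have "\<dots> \<le> (\<Sum>q\<le>r. 2 ^ q * \<bar>a q\<bar>) / 2 ^ r"
      by (intro divide_right_mono order_trans[OF sum_abs]) (auto simp: abs_mult)
    also have "\<dots> = (\<Sum>k\<le>r. 2 ^ (r - k) * \<bar>a (r - k)\<bar>) / 2 ^ r"
      by (intro arg_cong[where f = "\<lambda>s. s / 2 ^ r"] sum.reindex_bij_witness[where i = "\<lambda>k. r - k" and j = "\<lambda>k. r - k"]) auto
    also have "\<dots> = (\<Sum>k\<le>r. (1/2) ^ k * \<bar>a (r - k)\<bar>)"
      unfolding sum_divide_distrib by (intro sum.cong) (auto simp: power_diff power_divide)
    finally show ?thesis .
  qed
  obtain B where B: "\<And>q. \<bar>a q\<bar> \<le> B"
    using convergent_imp_Bseq[OF convergentI[OF a]] by (auto simp: Bseq_def)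
  \<comment> \<open>Extension by 0 beyond \<open>k = r\<close> turns the finite sums into series
    over a range that does not depend on \<open>r\<close>.\<close>
  define t where "t k r = (if k \<le> r then (1/2) ^ k * \<bar>a (r - k)\<bar> else 0)" for k r :: nat
  have "(\<lambda>r. \<Sum>k. t k r) \<longlonglongrightarrow> (\<Sum>k. 0)"
  proof (rule conjunct2[OF conjunct2[OF tannerys_theorem]])
    fix k
    \<comment> \<open>Shifting by \<open>k\<close> leaves only indices outside the zero
      branch.\<close>
    have "(\<lambda>r. t k (r + k)) \<longlonglongrightarrow> (1/2) ^ k * \<bar>0\<bar>"
      unfolding t_def using a by (simp add: tendsto_mult_right_zero tendsto_rabs_zero)
    then show "(\<lambda>r. t k r) \<longlonglongrightarrow> 0"
      using LIMSEQ_offset[of "t k" k] by simp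
  next
    show "\<forall>\<^sub>F (k, r) in at_top \<times>\<^sub>F sequentially. norm (t k r) \<le> (1/2) ^ k * B"
      using B order_trans[OF abs_ge_zero B]
      by (auto simp: t_def abs_mult intro!: always_eventually mult_left_mono)
    show "summable (\<lambda>k. (1/2) ^ k * B)"
      by (intro summable_mult2 summable_geometric) simp
  qed simp
  moreover have "(\<Sum>k. t k r) = (\<Sum>k\<le>r. (1/2) ^ k * \<bar>a (r - k)\<bar>)" for r
    by (subst suminf_finite[of "{..r}"]) (auto simp: t_def)
  ultimately have "(\<lambda>r. \<Sum>k\<le>r. (1/2) ^ k * \<bar>a (r - k)\<bar>) \<longlonglongrightarrow> 0"
    by simp
  then show ?thesis
    by (rule Lim_null_comparison[rotated]) (simp add: le)
qed

section \<open>Recursion of the second moments along the generations\<close>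

context admissible_bmc
begin

text \<open>On \<open>F\<close> this is the \<open>\<nu>\<close>-integral of
  \<open>(Qop ^^ q) g\<close>, see \<open>mean_eq\<close>. Defining it by expectations lets it also
  be applied to absolute values, which may lie outside \<open>F\<close>.\<close>

definition mean :: "nat \<Rightarrow> ('a \<Rightarrow> real) \<Rightarrow> real" where
  "mean q g = (\<Sum>i\<in>generation q. expectation (\<lambda>\<omega>. g (X i \<omega>))) / 2 ^ q"

text \<open>The divisor is the squared size of the generation, so this is the expected square of the
  average.\<close>

definition second_moment :: "nat \<Rightarrow> ('a \<Rightarrow> real) \<Rightarrow> real" where
  "second_moment q f = expectation (\<lambda>\<omega>. (\<Sum>i\<in>generation q. f (X i \<omega>))\<^sup>2) / 4 ^ q"

text \<open>For \<open>f \<in> F\<close> this is the normalized sum over ordered pairs of distinct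
  vertices: the diagonal amounts to \<open>2 ^ q\<close> times the mean of the square, divided by
  \<open>4 ^ q\<close>.\<close>

definition offdiag :: "nat \<Rightarrow> ('a \<Rightarrow> real) \<Rightarrow> real" where
  "offdiag q f = second_moment q f - mean q (\<lambda>x. (f x)\<^sup>2) / 2 ^ q"

lemma second_moment_eq:
  assumes "f \<in> F"
  shows "integrable M (\<lambda>\<omega>. (\<Sum>i\<in>generation q. f (X i \<omega>))\<^sup>2)"
    "4 ^ q * second_moment q f = (\<Sum>i\<in>generation q. \<Sum>j\<in>generation q. expectation (\<lambda>\<omega>. f (X i \<omega>) * f (X j \<omega>)))"
  using integrable_X_mult[OF _ _ assms assms]
  by (auto simp: second_moment_def power2_eq_square sum_product intro!: Bochner_Integration.integrable_sum)

lemma mean_Suc: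
  assumes "f \<in> F"
  shows "mean (Suc q) f = mean q (Qop f)"
proof -
  have "expectation (\<lambda>\<omega>. f (X (2 * n) \<omega>)) + expectation (\<lambda>\<omega>. f (X (2 * n + 1) \<omega>)) =
      2 * expectation (\<lambda>\<omega>. Qop f (X n \<omega>))" if n: "n \<in> generation q" for n
  proof -
    note e = expectation_tensor[OF n assms F_const[of 1]] expectation_tensor[OF n F_const[of 1] assms]
    have "expectation (\<lambda>\<omega>. Qop f (X n \<omega>)) =
        expectation (\<lambda>\<omega>. (kernel_apply P (tensor f (\<lambda>_. 1)) (X n \<omega>) + kernel_apply P (tensor (\<lambda>_. 1) f) (X n \<omega>)) / 2)"
      by (simp only: Qop_eq[OF assms])
    also have "\<dots> = (expectation (\<lambda>\<omega>. kernel_apply P (tensor f (\<lambda>_. 1)) (X n \<omega>)) +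
        expectation (\<lambda>\<omega>. kernel_apply P (tensor (\<lambda>_. 1) f) (X n \<omega>))) / 2"
      using integrable_X[OF n F_tensor[OF assms F_const[of 1]]] integrable_X[OF n F_tensor[OF F_const[of 1] assms]]
      by simp
    finally show ?thesis
      using e by simp
  qed
  then show ?thesis
    unfolding mean_def sum_generation_Suc by (simp flip: sum_distrib_left)
qed

lemma mean_eq:
  assumes "f \<in> F"
  shows "mean q f = (\<integral>x. (Qop ^^ q) f x \<partial>\<nu>)"
proof -
  have "distr M borel (X 1) = \<nu>"
    using bmc by (simp add: bifurcating_markov_chain_def)
  then have "mean 0 g = (\<integral>x. g x \<partial>\<nu>)" if "g \<in> F" for g
    using integral_distr[OF X_measurable F_measurable[OF that], of 1]
    by (simp add: mean_def generation_0)
  \<comment> \<open>\<open>k\<close> is general because each step trades one generation for one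
    application of \<open>Qop\<close>.\<close>
  moreover have "mean q ((Qop ^^ k) f) = mean 0 ((Qop ^^ (k + q)) f)" for k
  proof (induction q arbitrary: k)
    case (Suc q)
    show ?case
      using mean_Suc[OF F_Qop_iter[OF assms], of q k] Suc[of "Suc k"] by simp
  qed simp
  from this[of 0] have "mean q f = mean 0 ((Qop ^^ q) f)"
    by simp
  ultimately show ?thesis
    using F_Qop_iter[OF assms] by simp
qed

text \<open>One member of \<open>F\<close> dominates all iterates \<open>(Qop ^^ q) f\<close>, and
  it is \<open>\<nu>\<close>-integrable.\<close>

lemma mean_bounded:
  assumes "f \<in> F"
  obtains C where "0 \<le> C" "\<And>q. \<bar>mean q f\<bar> \<le> C"
proof -
  obtain g where g: "g \<in> F" "\<And>r x. \<bar>(Qop ^^ r) f x\<bar> \<le> g x"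
    by (rule Qop_iter_bound[OF assms]) (rule that)
  have "\<bar>mean q f\<bar> \<le> (\<integral>x. g x \<partial>\<nu>)" for q
    unfolding mean_eq[OF assms] using g
    by (intro order_trans[OF integral_abs_bound integral_mono] integrable_abs F_integrable_init F_Qop_iter assms)
  then show ?thesis
    using order_trans[OF abs_ge_zero] that by blast
qed

lemma offdiag_0: "offdiag 0 f = 0"
  by (simp add: offdiag_def second_moment_def mean_def generation_0)

text \<open>Pairs are grouped by their mothers. Distinct mothers give the off-diagonal part for
  \<open>Qop f\<close>. A common mother gives the new diagonal and twice the product of the sisters,
  whose total weight is \<open>2 * 2 ^ q / 4 ^ Suc q = 1 / (2 * 2 ^ q)\<close>.\<close>

lemma offdiag_Suc:
  assumes f: "f \<in> F"
  shows "offdiag (Suc q) f = offdiag q (Qop f) + mean q (kernel_apply P (tensor f f)) / (2 * 2 ^ q)"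
proof -
  let ?G = "generation q"
  define pl where "pl n = (\<lambda>\<omega>. f (X (2 * n) \<omega>) + f (X (2 * n + 1) \<omega>))" for n
  define e where "e n m = expectation (\<lambda>\<omega>. Qop f (X n \<omega>) * Qop f (X m \<omega>))" for n m
  define d where "d n = expectation (\<lambda>\<omega>. (f (X n \<omega>))\<^sup>2)" for n
  define c where "c n = expectation (\<lambda>\<omega>. kernel_apply P (tensor f f) (X n \<omega>))" for n
  have diag: "integrable M (\<lambda>\<omega>. pl n \<omega> * pl n \<omega>)"
    "expectation (\<lambda>\<omega>. pl n \<omega> * pl n \<omega>) = d (2 * n) + d (2 * n + 1) + 2 * c n"
    if n: "n \<in> ?G" for n
  proof -
    have eq: "pl n \<omega> * pl n \<omega> = (f (X (2 * n) \<omega>))\<^sup>2 + (f (X (2 * n + 1) \<omega>))\<^sup>2 +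
        2 * (f (X (2 * n) \<omega>) * f (X (2 * n + 1) \<omega>))" for \<omega>
      by (simp add: pl_def power2_eq_square algebra_simps)
    note i = integrable_X[OF conjunct1[OF daughters_in_generation[OF n]] F_square[OF f]]
      integrable_X[OF conjunct2[OF daughters_in_generation[OF n]] F_square[OF f]]
      integrable_X_mult[OF conjunct1[OF daughters_in_generation[OF n]]
        conjunct2[OF daughters_in_generation[OF n]] f f]
    show "integrable M (\<lambda>\<omega>. pl n \<omega> * pl n \<omega>)"
      unfolding eq using i by (intro Bochner_Integration.integrable_add integrable_mult_right)
    show "expectation (\<lambda>\<omega>. pl n \<omega> * pl n \<omega>) = d (2 * n) + d (2 * n + 1) + 2 * c n"
      unfolding eq using i expectation_tensor[OF n f f] by (simp add: d_def c_def)
  qed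
  have int: "integrable M (\<lambda>\<omega>. pl n \<omega> * pl m \<omega>)" if "n \<in> ?G" "m \<in> ?G" for n m
    unfolding pl_def distrib_left distrib_right
    using daughters_in_generation[OF that(1)] daughters_in_generation[OF that(2)]
    by (intro Bochner_Integration.integrable_add integrable_X_mult[of _ "Suc q" _ "Suc q"] f) auto
  \<comment> \<open>The diagonal is written as \<open>4 * e n n\<close> plus a correction, so that
    the full double sum of \<open>e\<close> is the second moment of \<open>Qop f\<close>.\<close>
  have e: "expectation (\<lambda>\<omega>. pl n \<omega> * pl m \<omega>) =
      4 * e n m + (if m = n then d (2 * n) + d (2 * n + 1) + 2 * c n - 4 * e n n else 0)"
    if "n \<in> ?G" "m \<in> ?G" for n m
    using diag(2)[OF that(1)] expectation_prod_plus[OF that _ f] by (auto simp: pl_def e_def)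
  have "4 ^ Suc q * second_moment (Suc q) f = expectation (\<lambda>\<omega>. (\<Sum>n\<in>?G. pl n \<omega>)\<^sup>2)"
    unfolding second_moment_def sum_generation_Suc pl_def by simp
  also have "\<dots> = (\<Sum>n\<in>?G. \<Sum>m\<in>?G. expectation (\<lambda>\<omega>. pl n \<omega> * pl m \<omega>))"
    unfolding power2_eq_square sum_product using int by simp
  also have "\<dots> = (\<Sum>n\<in>?G. \<Sum>m\<in>?G. 4 * e n m + (if m = n then d (2 * n) + d (2 * n + 1) + 2 * c n - 4 * e n n else 0))"
    by (intro sum.cong refl e)
  also have "\<dots> = 4 * (\<Sum>n\<in>?G. \<Sum>m\<in>?G. e n m) + (\<Sum>n\<in>?G. d (2 * n) + d (2 * n + 1)) +
      2 * (\<Sum>n\<in>?G. c n) - 4 * (\<Sum>n\<in>?G. e n n)"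
    by (simp add: sum.distrib sum_subtractf sum_distrib_left)
  also have "(\<Sum>n\<in>?G. \<Sum>m\<in>?G. e n m) = 4 ^ q * second_moment q (Qop f)"
    using second_moment_eq(2)[OF F_Qop[OF f]] by (simp add: e_def)
  also have "(\<Sum>n\<in>?G. d (2 * n) + d (2 * n + 1)) = 2 ^ Suc q * mean (Suc q) (\<lambda>x. (f x)\<^sup>2)"
    unfolding mean_def sum_generation_Suc by (simp add: d_def)
  also have "(\<Sum>n\<in>?G. c n) = 2 ^ q * mean q (kernel_apply P (tensor f f))"
    by (simp add: mean_def c_def)
  also have "(\<Sum>n\<in>?G. e n n) = 2 ^ q * mean q (\<lambda>x. (Qop f x)\<^sup>2)"
    by (simp add: mean_def e_def power2_eq_square)
  finally have *: "4 ^ Suc q * second_moment (Suc q) f = 4 * (4 ^ q * second_moment q (Qop f)) + 2 ^ Suc q * mean (Suc q) (\<lambda>x. (f x)\<^sup>2) +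
      2 * (2 ^ q * mean q (kernel_apply P (tensor f f))) - 4 * (2 ^ q * mean q (\<lambda>x. (Qop f x)\<^sup>2))" .
  have four: "(4::real) ^ q = 2 ^ q * 2 ^ q"
    by (simp add: power_mult_distrib[symmetric])
  \<comment> \<open>The subtracted term moves to the left and a factor \<open>2 ^ q\<close> is
    exposed for cancellation.\<close>
  have "2 ^ q * (2 * (2 ^ q * second_moment (Suc q) f) + 2 * mean q (\<lambda>x. (Qop f x)\<^sup>2)) =
      2 ^ q * (2 * (2 ^ q * second_moment q (Qop f)) + mean (Suc q) (\<lambda>x. (f x)\<^sup>2) + mean q (kernel_apply P (tensor f f)))"
    using * unfolding power_Suc four by (simp add: algebra_simps)
  then have "2 * (2 ^ q * second_moment (Suc q) f) + 2 * mean q (\<lambda>x. (Qop f x)\<^sup>2) =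
      2 * (2 ^ q * second_moment q (Qop f)) + mean (Suc q) (\<lambda>x. (f x)\<^sup>2) + mean q (kernel_apply P (tensor f f))"
    unfolding mult_cancel_left by simp
  then show ?thesis
    unfolding offdiag_def power_Suc by (simp add: field_simps)
qed

text \<open>Unrolling of \<open>offdiag_Suc\<close> down to generation 0. After \<open>r\<close>
  steps the function is \<open>(Qop ^^ r) f\<close> and the mothers are in generation
  \<open>q - Suc r\<close>.\<close>

lemma offdiag_eq:
  assumes "f \<in> F"
  shows "offdiag q f = (\<Sum>r<q. mean (q - Suc r) (kernel_apply P (tensor ((Qop ^^ r) f) ((Qop ^^ r) f))) / (2 * 2 ^ (q - Suc r)))"
proof -
  have "offdiag q ((Qop ^^ k) f) =
    (\<Sum>r<q. mean (q - Suc r) (kernel_apply P (tensor ((Qop ^^ (k + r)) f) ((Qop ^^ (k + r)) f))) / (2 * 2 ^ (q - Suc r)))" for k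
  proof (induction q arbitrary: k)
    case (Suc q)
    show ?case
      using offdiag_Suc[OF F_Qop_iter[OF assms], of q k] Suc[of "Suc k"]
      by (simp add: sum.lessThan_Suc_shift del: sum.lessThan_Suc)
  qed (simp add: offdiag_0)
  from this[of 0] show ?thesis
    by simp
qed

lemma summable_second_moment:
  assumes f: "f \<in> F" and h: "h \<in> F"
    and le: "\<And>x R. (\<Sum>r<R. \<bar>kernel_apply P (tensor ((Qop ^^ r) f) ((Qop ^^ r) f)) x\<bar>) \<le> h x"
  shows "summable (\<lambda>q. second_moment q f)"
proof -
  define c where "c r = kernel_apply P (tensor ((Qop ^^ r) f) ((Qop ^^ r) f))" for r
  have c: "c r \<in> F" for r
    unfolding c_def by (intro F_tensor F_Qop_iter f)
  obtain C where C: "0 \<le> C" "\<And>q. \<bar>mean q h\<bar> \<le> C"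
    by (rule mean_bounded[OF h]) (rule that)
  \<comment> \<open>\<open>b s r\<close> bounds the contribution of pairs whose last common ancestor
    is in generation \<open>s\<close> and which lie \<open>r\<close> generations below her
    daughters.\<close>
  define b where "b s r = mean s (\<lambda>x. \<bar>c r x\<bar>) / (2 * 2 ^ s)" for s r
  have S: "summable (\<lambda>q. \<Sum>r\<le>q. b (q - r) r)"
  proof (rule summable_diagonal)
    show "0 \<le> b s r" for s r
      by (auto simp: b_def mean_def intro!: divide_nonneg_nonneg sum_nonneg integral_nonneg_AE)
    show "(\<Sum>r<R. b s r) \<le> C * (1/2) ^ s" for s R
    proof -
      \<comment> \<open>The sum over \<open>r\<close> is brought inside the expectation, where
        \<open>h\<close> bounds it for all \<open>R\<close> at once; the means of \<open>h\<close>
        are bounded by \<open>C\<close> in every generation.\<close>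
      have "(\<Sum>r<R. mean s (\<lambda>x. \<bar>c r x\<bar>)) = (\<Sum>i\<in>generation s. \<Sum>r<R. expectation (\<lambda>\<omega>. \<bar>c r (X i \<omega>)\<bar>)) / 2 ^ s"
        unfolding mean_def sum_divide_distrib[symmetric] by (subst sum.swap) (rule refl)
      also have "\<dots> \<le> mean s h"
        unfolding mean_def
      proof (intro divide_right_mono sum_mono)
        fix i assume i: "i \<in> generation s"
        have "(\<Sum>r<R. expectation (\<lambda>\<omega>. \<bar>c r (X i \<omega>)\<bar>)) = expectation (\<lambda>\<omega>. \<Sum>r<R. \<bar>c r (X i \<omega>)\<bar>)"
          by (intro Bochner_Integration.integral_sum[symmetric] integrable_abs integrable_X[OF i] c)
        also have "\<dots> \<le> expectation (\<lambda>\<omega>. h (X i \<omega>))"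
          using le by (intro integral_mono Bochner_Integration.integrable_sum integrable_abs integrable_X[OF i] c h)
            (simp add: c_def)
        finally show "(\<Sum>r<R. expectation (\<lambda>\<omega>. \<bar>c r (X i \<omega>)\<bar>)) \<le> expectation (\<lambda>\<omega>. h (X i \<omega>))" .
      qed simp
      also have "\<dots> \<le> C"
        using C(2)[of s] by simp
      finally have "(\<Sum>r<R. mean s (\<lambda>x. \<bar>c r x\<bar>)) / (2 * 2 ^ s) \<le> C / (2 * 2 ^ s)"
        by (intro divide_right_mono) auto
      also have "\<dots> \<le> C * (1/2) ^ s"
        using C(1) by (simp add: field_simps power_divide)
      finally show ?thesis
        by (simp add: b_def sum_divide_distrib)
    qed
    show "summable (\<lambda>s. C * (1/2) ^ s)"
      by (intro summable_mult summable_geometric) simp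
  qed
  \<comment> \<open>The index \<open>Suc q\<close> makes the mothers' generation
    \<open>q - r\<close>, matching the diagonal sums in \<open>S\<close>.\<close>
  have le_b: "\<bar>offdiag (Suc q) f\<bar> \<le> (\<Sum>r\<le>q. b (q - r) r)" for q
  proof -
    have "\<bar>mean s (c r)\<bar> \<le> mean s (\<lambda>x. \<bar>c r x\<bar>)" for s r
      unfolding mean_def abs_divide
      by (intro divide_mono order_trans[OF sum_abs] sum_mono integral_abs_bound) (auto intro!: sum_nonneg)
    then show ?thesis
      unfolding offdiag_eq[OF f] b_def c_def[symmetric] lessThan_Suc_atMost
      by (intro order_trans[OF sum_abs] sum_mono) (simp add: abs_divide divide_right_mono)
  qed
  have "summable (\<lambda>q. offdiag (Suc q) f)"
    by (rule summable_comparison_test'[OF S, of 0]) (use le_b in simp)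
  then have 1: "summable (\<lambda>q. offdiag q f)"
    by (rule iffD1[OF summable_Suc_iff])
  obtain D where D: "0 \<le> D" "\<And>q. \<bar>mean q (\<lambda>x. (f x)\<^sup>2)\<bar> \<le> D"
    by (rule mean_bounded[OF F_square[OF f]]) (rule that)
  have "summable (\<lambda>q. mean q (\<lambda>x. (f x)\<^sup>2) / 2 ^ q)"
  proof (rule summable_comparison_test')
    show "summable (\<lambda>q. D * (1/2) ^ q)"
      by (intro summable_mult summable_geometric) simp
    show "norm (mean q (\<lambda>x. (f x)\<^sup>2) / 2 ^ q) \<le> D * (1/2) ^ q" if "0 \<le> q" for q
      using D(2)[of q] by (simp add: abs_divide power_divide divide_right_mono)
  qed
  from summable_add[OF 1 this] show ?thesis
    by (simp add: offdiag_def)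
qed

end

section \<open>Almost sure convergence from the summed second moments\<close>

theorem theorem14:
  fixes M :: "'w measure"
    and Fil :: "nat \<Rightarrow> 'w measure"
    and X :: "nat \<Rightarrow> 'w \<Rightarrow> 'a::metric_space"
    and \<nu> \<mu> :: "'a measure"
    and P :: "'a \<Rightarrow> ('a \<times> 'a) measure"
    and F :: "('a \<Rightarrow> real) set"
    and f :: "'a \<Rightarrow> real"
  assumes "bifurcating_markov_chain M Fil X \<nu> P"
    and "admissible P \<nu> \<mu> F"
    and "f \<in> F"
    and "(\<integral>x. f x \<partial>\<mu>) = 0"
    and "\<exists>h\<in>F. \<forall>x.
           enn2ereal (\<integral>\<^sup>+p. (\<Sum>r. ennreal \<bar>tensor (Qpow P r f) (Qpow P r f) p\<bar>) \<partial>(P x)) \<le> ereal (h x)"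
  shows "(AE \<omega> in M. (\<lambda>q. average X (generation q) f \<omega>) \<longlonglongrightarrow> 0) \<and>
         (AE \<omega> in M. (\<lambda>r. average X (tree_upto r) f \<omega>) \<longlonglongrightarrow> 0)"
proof -
  have "T_transition P"
    using assms(1) by (simp add: bifurcating_markov_chain_def)
  then interpret admissible_bmc P \<nu> \<mu> F M Fil X
    using assms by unfold_locales
  note f = \<open>f \<in> F\<close>
  obtain h where h: "h \<in> F" and
    h_le: "\<And>x. enn2ereal (\<integral>\<^sup>+p. (\<Sum>r. ennreal \<bar>tensor (Qpow P r f) (Qpow P r f) p\<bar>) \<partial>(P x)) \<le> ereal (h x)"
    using assms(5) by blast
  \<comment> \<open>Finite partial sums of absolute values of integrals are bounded by the integral
    of the whole series of absolute values, which the hypothesis controls.\<close>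
  have "(\<Sum>r<R. \<bar>kernel_apply P (tensor ((Qop ^^ r) f) ((Qop ^^ r) f)) x\<bar>) \<le> h x" for x R
  proof -
    let ?t = "\<lambda>r. tensor ((Qop ^^ r) f) ((Qop ^^ r) f)"
    have i: "integrable (P x) (?t r)" for r
      by (intro integrable_tensor F_Qop_iter f)
    have "(\<Sum>r<R. \<bar>kernel_apply P (?t r) x\<bar>) \<le> (\<Sum>r<R. \<integral>p. \<bar>?t r p\<bar> \<partial>P x)"
      unfolding kernel_apply_def by (intro sum_mono integral_abs_bound)
    also have "\<dots> = (\<integral>p. (\<Sum>r<R. \<bar>?t r p\<bar>) \<partial>P x)"
      using i by (intro Bochner_Integration.integral_sum[symmetric] integrable_abs)
    finally have "ennreal (\<Sum>r<R. \<bar>kernel_apply P (?t r) x\<bar>) \<le> ennreal (\<integral>p. (\<Sum>r<R. \<bar>?t r p\<bar>) \<partial>P x)"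
      by (rule ennreal_leI)
    also have "\<dots> = (\<integral>\<^sup>+p. ennreal (\<Sum>r<R. \<bar>?t r p\<bar>) \<partial>P x)"
      using i by (intro nn_integral_eq_integral[symmetric] Bochner_Integration.integrable_sum integrable_abs)
        (auto intro!: sum_nonneg)
    also have "\<dots> \<le> (\<integral>\<^sup>+p. (\<Sum>r. ennreal \<bar>?t r p\<bar>) \<partial>P x)"
      by (intro nn_integral_mono) (auto simp flip: sum_ennreal intro!: sum_le_suminf)
    \<comment> \<open>The comparison with \<open>h x\<close> takes place in \<open>ereal\<close>,
      since \<open>ennreal (h x)\<close> would replace a negative value by 0.\<close>
    finally have "enn2ereal (ennreal (\<Sum>r<R. \<bar>kernel_apply P (?t r) x\<bar>)) \<le>
        enn2ereal (\<integral>\<^sup>+p. (\<Sum>r. ennreal \<bar>?t r p\<bar>) \<partial>P x)"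
      by (simp add: less_eq_ennreal.rep_eq)
    also have "\<dots> \<le> ereal (h x)"
      using h_le[of x] by (simp add: Qpow_eq f)
    finally show ?thesis
      by (simp add: enn2ereal_ennreal sum_nonneg)
  qed
  from summable_second_moment[OF f h this] have s: "summable (\<lambda>q. second_moment q f)" .
  have sq: "(average X (generation q) f \<omega>)\<^sup>2 = (\<Sum>i\<in>generation q. f (X i \<omega>))\<^sup>2 / 4 ^ q" for q \<omega>
    by (simp add: average_def card_generation power_divide power2_eq_square flip: power_mult_distrib)
  have "AE \<omega> in M. (\<lambda>q. average X (generation q) f \<omega>) \<longlonglongrightarrow> 0"
  proof (rule AE_tendsto_zero_of_summable_second_moments)
    show "(\<lambda>\<omega>. average X (generation q) f \<omega>) \<in> borel_measurable M" for q
      unfolding average_def using integrable_X[OF _ f]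
      by (intro borel_measurable_divide borel_measurable_sum) auto
    show "integrable M (\<lambda>\<omega>. (average X (generation q) f \<omega>)\<^sup>2)" for q
      unfolding sq by (intro integrable_divide second_moment_eq f)
    show "summable (\<lambda>q. expectation (\<lambda>\<omega>. (average X (generation q) f \<omega>)\<^sup>2))"
      unfolding sq using s by (simp add: second_moment_def)
  qed
  moreover from this have "AE \<omega> in M. (\<lambda>r. average X (tree_upto r) f \<omega>) \<longlonglongrightarrow> 0"
    by eventually_elim (rule average_tree_tendsto)
  ultimately show ?thesis ..
qed

end
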